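(* Let $n\ge2$ and $\mathfrak g=\mathfrak{sl}(n,\mathbb C)$. The following are equivalent for $s\in\mathbb C$. (i) The generalized Verma module $M_{\mathfrak p}(\mathrm{triv},s)$ is reducible (as a $\mathfrak g$-module). (ii) $s\in\mathbb Z_{\ge0}$.
   Context: Let $\mathfrak p=\mathfrak m\oplus\mathfrak a\oplus\mathfrak n_+$ be the maximal parabolic subalgebra of $\mathfrak g=\mathfrak{sl}(n,\mathbb C)$ for the partition $n=1+(n-1)$: with $E_{i,j}$ the matrix units, $\mathfrak n_+=\mathrm{span}_{\mathbb C}\{E_{1,j+1}:1\le j\le n-1\}$, $\mathfrak a=\mathbb C\widetilde H_0$ with $\widetilde H_0=\frac1{n-1}\mathrm{diag}(n-1,-1,\dots,-1)$, and $\mathfrak m=\{\mathrm{diag}(0,X):X\in\mathfrak{sl}(n-1,\mathbb C)\}$ (with $\mathfrak{sl}(1,\mathbb C)=\{0\}$). $M_{\mathfrak p}(\mathrm{triv},s)=\mathcal U(\mathfrak g)\otimes_{\mathcal U(\mathfrak p)}\mathbb C$, where on $\mathbb C$ the subalgebras $\mathfrak m$ and $\mathfrak n_+$ act by $0$ and $\widetilde H_0$ acts by the scalar $s$. *)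

theory Defs
  imports
    Complex_Main
    "HOL-Library.Poly_Mapping"
    "HOL-Algebra.QuotRing"
    "HOL-Algebra.Free_Abelian_Groups"
    "Jordan_Normal_Form.Matrix"
begin

section \<open>Universal enveloping algebras of matrix Lie algebras\<close>

text \<open>
  Lists form the free monoid, so with the convolution product of \<^theory>\<open>HOL-Library.Poly_Mapping\<close>
  the type \<^typ>\<open>'a list \<Rightarrow>\<^sub>0 complex\<close> is the free associative unital complex algebra on \<^typ>\<open>'a\<close>.
\<close>

instantiation list :: (type) monoid_add
begin

definition zero_list :: "'a list" where "zero_list = []"

definition plus_list :: "'a list \<Rightarrow> 'a list \<Rightarrow> 'a list" where "plus_list = (@)"

instance by standard (simp_all add: zero_list_def plus_list_def)

end

type_synonym 'a free_alg = "'a list \<Rightarrow>\<^sub>0 complex"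

definition free_algebra :: "'a set \<Rightarrow> 'a free_alg ring" where
  "free_algebra S =
    \<lparr>carrier = {f. \<forall>w \<in> Poly_Mapping.keys f. set w \<subseteq> S}, monoid.mult = (*), one = 1, ring.zero = 0, ring.add = (+)\<rparr>"

definition gen :: "'a \<Rightarrow> 'a free_alg" where
  "gen x = Poly_Mapping.single [x] 1"

definition scal :: "complex \<Rightarrow> 'a free_alg" where
  "scal c = Poly_Mapping.single [] c"

text \<open>
  A Lie algebra is a set \<open>g\<close> of square matrices closed under linear combinations and under the
  commutator. The first two families of relations turn the free algebra on the set \<open>g\<close> into the
  tensor algebra of the vector space \<open>g\<close>; the third one identifies commutators with brackets.
\<close>

definition uea_rels :: "complex mat set \<Rightarrow> complex mat free_alg set" where
  "uea_rels g =
     {gen (x + y) - gen x - gen y | x y. x \<in> g \<and> y \<in> g} \<union>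
     {gen (c \<cdot>\<^sub>m x) - scal c * gen x | c x. x \<in> g} \<union>
     {gen x * gen y - gen y * gen x - gen (x * y - y * x) | x y. x \<in> g \<and> y \<in> g}"

definition uea_ideal :: "complex mat set \<Rightarrow> complex mat free_alg set" where
  "uea_ideal g = genideal (free_algebra g) (uea_rels g)"

definition uea :: "complex mat set \<Rightarrow> complex mat free_alg set ring" where
  "uea g = free_algebra g Quot uea_ideal g"

definition uea_class :: "complex mat set \<Rightarrow> complex mat free_alg \<Rightarrow> complex mat free_alg set" where
  "uea_class g f = uea_ideal g +>\<^bsub>free_algebra g\<^esub> f"

text \<open>
  For \<open>p \<subseteq> g\<close>, the canonical homomorphism \<open>U(p) \<rightarrow> U(g)\<close>: the class of \<open>f\<close> modulo the ideal of \<open>p\<close> is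
  enlarged to the class of \<open>f\<close> modulo the ideal of \<open>g\<close>.
\<close>

definition uea_map :: "complex mat set \<Rightarrow> complex mat free_alg set \<Rightarrow> complex mat free_alg set" where
  "uea_map g r = uea_ideal g <+>\<^bsub>free_algebra g\<^esub> r"

text \<open>
  Extension of an action \<open>\<rho>\<close> of a Lie algebra on the vector space of complex numbers: a word
  \<open>x\<^sub>1 \<dots> x\<^sub>k\<close> acts by \<open>\<rho> x\<^sub>1 \<circ> \<dots> \<circ> \<rho> x\<^sub>k\<close>. On the enveloping algebra all representatives of a class
  act in the same way, which is what \<^const>\<open>the_elem\<close> refers to.
\<close>

definition free_action :: "('a \<Rightarrow> complex \<Rightarrow> complex) \<Rightarrow> 'a free_alg \<Rightarrow> complex \<Rightarrow> complex" where
  "free_action \<rho> f v = (\<Sum>w \<in> Poly_Mapping.keys f. Poly_Mapping.lookup f w * foldr \<rho> w v)"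

definition uea_action ::
  "(complex mat \<Rightarrow> complex \<Rightarrow> complex) \<Rightarrow> complex mat free_alg set \<Rightarrow> complex \<Rightarrow> complex" where
  "uea_action \<rho> r v = the_elem ((\<lambda>f. free_action \<rho> f v) ` r)"

section \<open>Induced modules\<close>

text \<open>
  The tensor product of \<open>U(g)\<close> (as a right \<open>U(p)\<close>-module) and the complex numbers (as a left
  \<open>U(p)\<close>-module via \<open>\<rho>\<close>) over the noncommutative ring \<open>U(p)\<close>: the quotient of the free abelian
  group on pairs \<open>(u, v)\<close> by biadditivity and \<open>u r \<otimes> v = u \<otimes> r v\<close>. As the theory of quotient groups
  is written multiplicatively, so is the group \<open>ind_module\<close>; its unit is the zero vector.
\<close>

type_synonym ind_free = "(complex mat free_alg set \<times> complex) \<Rightarrow>\<^sub>0 int"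

definition ind_free_group :: "complex mat set \<Rightarrow> ind_free monoid" where
  "ind_free_group g = free_Abelian_group (carrier (uea g) \<times> UNIV)"

definition ind_rels ::
  "complex mat set \<Rightarrow> complex mat set \<Rightarrow> (complex mat \<Rightarrow> complex \<Rightarrow> complex) \<Rightarrow> ind_free set" where
  "ind_rels g p \<rho> =
     {frag_of (u \<oplus>\<^bsub>uea g\<^esub> u', v) - frag_of (u, v) - frag_of (u', v) | u u' v.
        u \<in> carrier (uea g) \<and> u' \<in> carrier (uea g)} \<union>
     {frag_of (u, v + v') - frag_of (u, v) - frag_of (u, v') | u v v'.
        u \<in> carrier (uea g)} \<union>
     {frag_of (u \<otimes>\<^bsub>uea g\<^esub> uea_map g r, v) - frag_of (u, uea_action \<rho> r v) | u r v.
        u \<in> carrier (uea g) \<and> r \<in> carrier (uea p)}"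

definition ind_kernel ::
  "complex mat set \<Rightarrow> complex mat set \<Rightarrow> (complex mat \<Rightarrow> complex \<Rightarrow> complex) \<Rightarrow> ind_free set" where
  "ind_kernel g p \<rho> = generate (ind_free_group g) (ind_rels g p \<rho>)"

definition ind_module ::
  "complex mat set \<Rightarrow> complex mat set \<Rightarrow> (complex mat \<Rightarrow> complex \<Rightarrow> complex) \<Rightarrow> ind_free set monoid" where
  "ind_module g p \<rho> = ind_free_group g Mod ind_kernel g p \<rho>"

text \<open>The action \<open>a (u \<otimes> v) = (a u) \<otimes> v\<close> of an element \<open>a\<close> of \<open>U(g)\<close>.\<close>

definition ind_action ::
  "complex mat set \<Rightarrow> complex mat set \<Rightarrow> (complex mat \<Rightarrow> complex \<Rightarrow> complex) \<Rightarrow>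
   complex mat free_alg set \<Rightarrow> ind_free set \<Rightarrow> ind_free set" where
  "ind_action g p \<rho> a X =
     ind_kernel g p \<rho> <#>\<^bsub>ind_free_group g\<^esub>
       frag_extend (\<lambda>(u, v). frag_of (a \<otimes>\<^bsub>uea g\<^esub> u, v)) ` X"

text \<open>
  Modules over a complex Lie algebra \<open>g\<close>, given by an abelian group \<open>M\<close> (written multiplicatively), a
  scalar multiplication \<open>sc\<close> and an action \<open>ac\<close> of \<open>g\<close>.
\<close>

definition lie_submodule ::
  "'x set \<Rightarrow> 'm monoid \<Rightarrow> (complex \<Rightarrow> 'm \<Rightarrow> 'm) \<Rightarrow> ('x \<Rightarrow> 'm \<Rightarrow> 'm) \<Rightarrow> 'm set \<Rightarrow> bool" where
  "lie_submodule g M sc ac N \<longleftrightarrow>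
     subgroup N M \<and> (\<forall>c. \<forall>m \<in> N. sc c m \<in> N) \<and> (\<forall>x \<in> g. \<forall>m \<in> N. ac x m \<in> N)"

definition lie_reducible ::
  "'x set \<Rightarrow> 'm monoid \<Rightarrow> (complex \<Rightarrow> 'm \<Rightarrow> 'm) \<Rightarrow> ('x \<Rightarrow> 'm \<Rightarrow> 'm) \<Rightarrow> bool" where
  "lie_reducible g M sc ac \<longleftrightarrow>
     (\<exists>N. lie_submodule g M sc ac N \<and> N \<noteq> {\<one>\<^bsub>M\<^esub>} \<and> N \<noteq> carrier M)"

section \<open>The maximal parabolic subalgebra for the partition \<open>n = 1 + (n - 1)\<close>\<close>

text \<open>Matrix indices start at 0, so the matrix unit with indices \<open>(1, j + 1)\<close> is \<open>mat_unit n 0 j\<close>.\<close>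

definition sl :: "nat \<Rightarrow> complex mat set" where
  "sl n = {A \<in> carrier_mat n n. (\<Sum>i < n. A $$ (i, i)) = 0}"

definition mat_unit :: "nat \<Rightarrow> nat \<Rightarrow> nat \<Rightarrow> complex mat" where
  "mat_unit n i j = mat n n (\<lambda>(k, l). if k = i \<and> l = j then 1 else 0)"

definition levi_m :: "nat \<Rightarrow> complex mat set" where
  "levi_m n = {four_block_mat (0\<^sub>m 1 1) (0\<^sub>m 1 (n - 1)) (0\<^sub>m (n - 1) 1) X | X. X \<in> sl (n - 1)}"

definition H0 :: "nat \<Rightarrow> complex mat" where
  "H0 n = (1 / of_nat (n - 1)) \<cdot>\<^sub>m mat_diag n (\<lambda>i. if i = 0 then of_nat (n - 1) else - 1)"

definition nil_plus :: "nat \<Rightarrow> complex mat set" where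
  "nil_plus n = {mat n n (\<lambda>ij. \<Sum>k = 1..n - 1. c k * mat_unit n 0 k $$ ij) | c. True}"

definition parabolic :: "nat \<Rightarrow> complex mat set" where
  "parabolic n = {Y + c \<cdot>\<^sub>m H0 n + Z | Y c Z. Y \<in> levi_m n \<and> Z \<in> nil_plus n}"

text \<open>
  The one-dimensional representation of the parabolic subalgebra on which \<open>levi_m\<close> and \<open>nil_plus\<close> act
  by 0 and \<open>H0\<close> acts by \<open>s\<close>. The decomposition of a matrix in \<open>parabolic n\<close> is unique for \<open>n \<ge> 2\<close>.
\<close>

definition triv_rep :: "nat \<Rightarrow> complex \<Rightarrow> complex mat \<Rightarrow> complex \<Rightarrow> complex" where
  "triv_rep n s A v =
     (THE w. \<exists>Y c Z. Y \<in> levi_m n \<and> Z \<in> nil_plus n \<and> A = Y + c \<cdot>\<^sub>m H0 n + Z \<and> w = c * (s * v))"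

section \<open>The generalized Verma module\<close>

definition gen_verma :: "nat \<Rightarrow> complex \<Rightarrow> ind_free set monoid" where
  "gen_verma n s = ind_module (sl n) (parabolic n) (triv_rep n s)"

definition gen_verma_scale :: "nat \<Rightarrow> complex \<Rightarrow> complex \<Rightarrow> ind_free set \<Rightarrow> ind_free set" where
  "gen_verma_scale n s c = ind_action (sl n) (parabolic n) (triv_rep n s) (uea_class (sl n) (scal c))"

definition gen_verma_action :: "nat \<Rightarrow> complex \<Rightarrow> complex mat \<Rightarrow> ind_free set \<Rightarrow> ind_free set" where
  "gen_verma_action n s x = ind_action (sl n) (parabolic n) (triv_rep n s) (uea_class (sl n) (gen x))"

end

theory Submission
  imports Defs "HOL-Library.Function_Algebras"
begin

text \<open>
  As a module over the opposite nilpotent radical, the generalized Verma module \<open>M\<close> is a polynomial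
  ring in the commuting lowering operators \<open>y\<^sub>k = E\<^sub>k\<^sub>,\<^sub>0\<close> for \<open>0 < k < n\<close>, and in these coordinates
  \<open>sl n\<close> acts by differential operators. On the monomial \<open>y\<^sup>a\<close> of degree \<open>d\<close> the raising operator
  \<open>E\<^sub>0\<^sub>,\<^sub>k\<close> gives \<open>a\<^sub>k (s - d + 1) y\<^bsup>a - e\<^sub>k\<^esup>\<close>. If \<open>s\<close> is not a natural number, the factor \<open>s - d + 1\<close>
  never vanishes for \<open>d \<ge> 1\<close>, so every nonzero vector can be lowered in degree until a nonzero
  multiple of the generator \<open>1 \<otimes> 1\<close> is reached, and \<open>M\<close> is irreducible. If \<open>s = m\<close> is a natural
  number, the factor vanishes for \<open>d = m + 1\<close>, so the vectors of degree greater than \<open>m\<close> form a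
  proper nonzero submodule.

  Each direction of the proof compares \<open>M\<close> with its polynomial model by a homomorphism in one
  direction. In the reducible case it goes from \<open>M\<close> to the model and exists by the universal property
  of an induced module (\<open>ind_vec_eq_one_imp_act\<close>): the submodule is the preimage of the functions
  of high degree, and it is proper and nonzero because \<open>1 \<otimes> 1\<close> and \<open>y\<^sub>1\<^bsup>m + 1\<^esup> \<otimes> 1\<close> have known images.
  In the irreducible case it is a surjection from the model to \<open>M\<close> (\<open>low_poly_spans\<close>): it pulls
  a nonzero submodule of \<open>M\<close> back to a nonzero submodule of the model, where the descent by raising
  operators takes place (\<open>low_poly_descent\<close>). The surjection is shown to be equivariant by induction
  on the degree (\<open>intertwines_delta\<close>), which rests on the bracket relations of the model.

  Computations in \<open>M\<close> are carried out in the free algebra \<open>T\<close> on the set \<open>sl n\<close>. The map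
  \<open>f \<mapsto> [f] \<otimes> 1\<close> (\<open>ind_vec\<close>) is additive, equivariant and onto, so that submodules of \<open>M\<close> correspond
  to left ideals of \<open>T\<close> containing the defining ideal of the enveloping algebra and the elements
  \<open>x - \<chi> x\<close> for \<open>x\<close> in the parabolic subalgebra; these left ideals form the locale
  \<open>vacuum_left_ideal\<close>. Membership in them is a statement about the ring type of \<open>T\<close>.

  The bracket relations of the model become a single scalar identity (\<open>coef_bracket\<close>) after two
  changes. An extra coordinate with index \<open>0\<close>, whose exponent is minus the degree, puts the matrix unit
  \<open>E\<^sub>i\<^sub>,\<^sub>j\<close> into the uniform shape of a weighted shift of exponents by \<open>\<epsilon> i - \<epsilon> j\<close>; and arbitrary
  functions of an integral exponent are admitted, so that exponents can be shifted without
  restriction. Polynomials are the functions in \<open>Pol n\<close>.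
\<close>

section \<open>Linear functionals and representations of the free algebra\<close>

definition linext :: "('a list \<Rightarrow> complex) \<Rightarrow> 'a free_alg \<Rightarrow> complex" where
  "linext t f = (\<Sum>w\<in>Poly_Mapping.keys f. Poly_Mapping.lookup f w * t w)"

lemma linext_superset:
  assumes "finite A" "Poly_Mapping.keys f \<subseteq> A"
  shows "linext t f = (\<Sum>w\<in>A. Poly_Mapping.lookup f w * t w)"
  unfolding linext_def
  by (rule sum.mono_neutral_left) (use assms in \<open>auto simp: in_keys_iff\<close>)

lemma linext_0 [simp]: "linext t 0 = 0"
  by (simp add: linext_def)

lemma linext_single [simp]: "linext t (Poly_Mapping.single w c) = c * t w"
  by (simp add: linext_def)

lemma linext_add [simp]: "linext t (f + g) = linext t f + linext t g"
proof -
  let ?A = "Poly_Mapping.keys f \<union> Poly_Mapping.keys g"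
  have "linext t (f + g) = (\<Sum>w\<in>?A. Poly_Mapping.lookup (f + g) w * t w)"
    by (rule linext_superset) (simp_all add: Poly_Mapping.keys_add)
  also have "\<dots> = linext t f + linext t g"
    by (simp add: lookup_add distrib_right sum.distrib linext_superset[of ?A])
  finally show ?thesis .
qed

lemma linext_uminus [simp]: "linext t (- f) = - linext t f"
  by (simp add: linext_def sum_negf)

lemma linext_diff [simp]: "linext t (f - g) = linext t f - linext t g"
  using linext_add[of t f "- g"] by simp

lemma linext_plus_fun: "linext (\<lambda>w. t w + t' w) f = linext t f + linext t' f"
  by (simp add: linext_def sum.distrib distrib_left)

lemma linext_mult_fun: "linext (\<lambda>w. c * t w) f = c * linext t f"
  by (simp add: linext_def sum_distrib_left mult.left_commute)

lemma linext_mult_fun_right: "linext (\<lambda>w. t w * c) f = linext t f * c"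
  by (simp add: linext_def sum_distrib_right mult.assoc)

lemma linext_cong:
  "(\<And>w. w \<in> Poly_Mapping.keys f \<Longrightarrow> t w = t' w) \<Longrightarrow> linext t f = linext t' f"
  by (simp add: linext_def)

abbreviation free_alg_on :: "'a set \<Rightarrow> 'a free_alg set" where
  "free_alg_on S \<equiv> carrier (free_algebra S)"

lemma free_alg_on_iff: "f \<in> free_alg_on S \<longleftrightarrow> (\<forall>w\<in>Poly_Mapping.keys f. set w \<subseteq> S)"
  by (simp add: free_algebra_def)

lemma single_mult_word:
  "Poly_Mapping.single u c * Poly_Mapping.single w d = Poly_Mapping.single (u @ w) (c * d)"
  by (simp add: mult_single plus_list_def)

lemma single_Nil_1: "Poly_Mapping.single [] 1 = (1 :: 'a free_alg)"
  by (metis single_one zero_list_def)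

lemma single_Cons: "Poly_Mapping.single (x # w) c = gen x * Poly_Mapping.single w c"
  by (simp add: gen_def single_mult_word)

lemma single_eq_scal_mult: "Poly_Mapping.single w c = scal c * Poly_Mapping.single w 1"
  by (simp add: scal_def single_mult_word)

lemma scal_add: "scal (c + d) = scal c + scal d"
  by (simp add: scal_def single_add)

lemma scal_mult: "scal (c * d) = scal c * scal d"
  by (simp add: scal_def single_mult_word)

lemma scal_0 [simp]: "scal 0 = 0"
  by (simp add: scal_def)

lemma scal_1 [simp]: "scal 1 = 1"
  by (simp add: scal_def single_Nil_1)

lemma scal_minus: "scal (- c) = - scal c"
  by (simp add: scal_def single_uminus)

lemma free_alg_on_0 [simp]: "0 \<in> free_alg_on S"
  and free_alg_on_single: "set w \<subseteq> S \<Longrightarrow> Poly_Mapping.single w c \<in> free_alg_on S"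
  by (auto simp: free_alg_on_iff)

lemma free_alg_on_scal [simp]: "scal c \<in> free_alg_on S"
  and free_alg_on_gen: "x \<in> S \<Longrightarrow> gen x \<in> free_alg_on S"
  by (auto simp: scal_def gen_def intro: free_alg_on_single)

lemma free_alg_on_1 [simp]: "1 \<in> free_alg_on S"
  using free_alg_on_scal[of 1 S] by simp

lemma free_alg_on_add: "f \<in> free_alg_on S \<Longrightarrow> g \<in> free_alg_on S \<Longrightarrow> f + g \<in> free_alg_on S"
  using Poly_Mapping.keys_add[of f g] by (auto simp: free_alg_on_iff)

lemma free_alg_on_uminus: "f \<in> free_alg_on S \<Longrightarrow> - f \<in> free_alg_on S"
  by (auto simp: free_alg_on_iff)

lemma free_alg_on_diff: "f \<in> free_alg_on S \<Longrightarrow> g \<in> free_alg_on S \<Longrightarrow> f - g \<in> free_alg_on S"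
  using free_alg_on_add[OF _ free_alg_on_uminus] by fastforce

lemma free_alg_on_mult: "f \<in> free_alg_on S \<Longrightarrow> g \<in> free_alg_on S \<Longrightarrow> f * g \<in> free_alg_on S"
  using keys_mult[of f g] by (fastforce simp: free_alg_on_iff plus_list_def)

lemma free_alg_on_mono: "S \<subseteq> S' \<Longrightarrow> f \<in> free_alg_on S \<Longrightarrow> f \<in> free_alg_on S'"
  by (auto simp: free_alg_on_iff)

lemmas free_alg_on_intros = free_alg_on_add free_alg_on_diff free_alg_on_mult free_alg_on_gen
  free_alg_on_scal free_alg_on_0 free_alg_on_1

lemma free_alg_on_monom_induct [consumes 1, case_names zero add single]:
  assumes f: "f \<in> free_alg_on S"
    and zero: "P 0" and add: "\<And>f g. P f \<Longrightarrow> P g \<Longrightarrow> P (f + g)"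
    and single: "\<And>w c. set w \<subseteq> S \<Longrightarrow> P (Poly_Mapping.single w c)"
  shows "P f"
proof -
  have "P (\<Sum>w\<in>A. Poly_Mapping.single w (Poly_Mapping.lookup f w))"
    if "finite A" "A \<subseteq> Poly_Mapping.keys f" for A
    using that
  proof induction
    case (insert w A)
    have "set w \<subseteq> S" using insert f by (auto simp: free_alg_on_iff)
    then show ?case using insert by (simp add: add single)
  qed (simp add: zero)
  moreover have "(\<Sum>w\<in>Poly_Mapping.keys f. Poly_Mapping.single w (Poly_Mapping.lookup f w)) = f"
    by (rule poly_mapping_eqI) (simp add: lookup_sum lookup_single when_def in_keys_iff)
  ultimately show ?thesis
    by (metis finite_keys order_refl)
qed

text \<open>
  The free algebra is generated by \<open>1\<close> as a left module over itself, so a property of all of its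
  elements can be established by multiplying with scalars and generators from the left only. For left
  ideals and cyclic modules this is the appropriate form of induction.
\<close>

lemma free_alg_on_word_induct [consumes 1, case_names one add scal gen]:
  assumes f: "f \<in> free_alg_on S"
    and one: "P 1" and add: "\<And>f g. P f \<Longrightarrow> P g \<Longrightarrow> P (f + g)"
    and scal: "\<And>c f. f \<in> free_alg_on S \<Longrightarrow> P f \<Longrightarrow> P (scal c * f)"
    and gen: "\<And>x f. x \<in> S \<Longrightarrow> f \<in> free_alg_on S \<Longrightarrow> P f \<Longrightarrow> P (gen x * f)"
  shows "P f"
proof -
  have word: "P (Poly_Mapping.single w 1)" if "set w \<subseteq> S" for w
    using that
  proof (induction w)
    case Nil
    show ?case using one by (simp only: single_Nil_1)
  next
    case (Cons x w)
    then show ?case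
      by (auto simp: single_Cons intro!: gen free_alg_on_single)
  qed
  show ?thesis using f
  proof (induction rule: free_alg_on_monom_induct)
    case zero
    show ?case using scal[OF _ one, of 0] by simp
  next
    case (single w c)
    then show ?case
      by (subst single_eq_scal_mult) (intro scal word free_alg_on_single)
  qed (rule add)
qed

text \<open>
  Multiplication of words is concatenation, hence a linear functional of a product is an iterated
  linear extension. This is the source of multiplicativity for characters and for \<open>act\<close> below.
\<close>

lemma linext_mult:
  "linext t (f * g) = linext (\<lambda>u. linext (\<lambda>w. t (u @ w)) g) f"
proof -
  have f: "f \<in> free_alg_on UNIV" and g: "g \<in> free_alg_on UNIV"
    by (simp_all add: free_alg_on_iff)
  show ?thesis using f
  proof (induction rule: free_alg_on_monom_induct)
    case (single u c)
    show ?case using g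
      by (induction rule: free_alg_on_monom_induct)
        (simp_all add: single_mult_word distrib_left)
  qed (simp_all add: distrib_right)
qed

lemma linext_multiplicative:
  assumes "\<And>u w. t (u @ w) = t u * t w"
  shows "linext t (f * g) = linext t f * linext t g"
  by (simp add: linext_mult assms linext_mult_fun linext_mult_fun_right)

text \<open>
  The representation spaces are spaces of complex functions, so that linear combinations indexed by
  words can be formed pointwise with \<^const>\<open>linext\<close>.
\<close>

definition linear_op :: "(('i \<Rightarrow> complex) \<Rightarrow> 'i \<Rightarrow> complex) \<Rightarrow> bool" where
  "linear_op T \<longleftrightarrow> (\<forall>F G. T (F + G) = T F + T G) \<and> (\<forall>c F. T (\<lambda>i. c * F i) = (\<lambda>i. c * T F i))"

lemma linear_op_linext:
  assumes "linear_op T"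
  shows "T (\<lambda>i. linext (\<lambda>w. G w i) f) = (\<lambda>i. linext (\<lambda>w. T (G w) i) f)"
proof -
  have "T (\<lambda>i. linext (\<lambda>w. G w i) f) i = linext (\<lambda>w. T (G w) i) f" for i
  proof -
    have add: "T (\<lambda>i. F i + H i) = (\<lambda>i. T F i + T H i)" for F H
      using assms unfolding linear_op_def plus_fun_def by blast
    have mult: "T (\<lambda>i. c * F i) = (\<lambda>i. c * T F i)" for c F
      using assms unfolding linear_op_def by blast
    have zero: "T (\<lambda>i. 0) = (\<lambda>i. 0)" using mult[of 0 "\<lambda>_. 0"] by simp
    have "f \<in> free_alg_on UNIV" by (simp add: free_alg_on_iff)
    then show ?thesis
      by (induction rule: free_alg_on_monom_induct) (simp_all add: add mult zero)
  qed
  then show ?thesis by blast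
qed

definition act :: "('a \<Rightarrow> ('i \<Rightarrow> complex) \<Rightarrow> 'i \<Rightarrow> complex) \<Rightarrow> 'a free_alg \<Rightarrow> ('i \<Rightarrow> complex) \<Rightarrow> 'i \<Rightarrow> complex" where
  "act \<phi> f F = (\<lambda>i. linext (\<lambda>w. foldr \<phi> w F i) f)"

lemma act_0 [simp]: "act \<phi> 0 F = 0"
  and act_add: "act \<phi> (f + g) F = act \<phi> f F + act \<phi> g F"
  and act_diff: "act \<phi> (f - g) F = act \<phi> f F - act \<phi> g F"
  and act_gen: "act \<phi> (gen x) F = \<phi> x F"
  and act_scal: "act \<phi> (scal c) F = (\<lambda>i. c * F i)"
  by (simp_all add: act_def gen_def scal_def fun_eq_iff)

lemma act_1 [simp]: "act \<phi> 1 F = F"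
  using act_scal[of \<phi> 1 F] by simp

lemma linear_op_foldr: "(\<And>x. linear_op (\<phi> x)) \<Longrightarrow> linear_op (foldr \<phi> w)"
  by (induction w) (simp_all add: linear_op_def)

lemma linear_op_act:
  assumes "\<And>x. linear_op (\<phi> x)"
  shows "linear_op (act \<phi> f)"
proof -
  have "linear_op (foldr \<phi> w)" for w by (rule linear_op_foldr[OF assms])
  then show ?thesis
    by (simp add: linear_op_def act_def fun_eq_iff linext_plus_fun linext_mult_fun)
qed

lemma act_mult:
  assumes "\<And>x. linear_op (\<phi> x)"
  shows "act \<phi> (f * g) F = act \<phi> f (act \<phi> g F)"
proof -
  have "foldr \<phi> u (\<lambda>i. linext (\<lambda>w. foldr \<phi> w F i) g) = (\<lambda>i. linext (\<lambda>w. foldr \<phi> u (foldr \<phi> w F) i) g)" for u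
    by (rule linear_op_linext[OF linear_op_foldr[OF assms]])
  then show ?thesis
    by (simp add: act_def linext_mult)
qed

section \<open>The enveloping algebra as a quotient of the free algebra\<close>

lemma free_algebra_simps [simp]:
  "x \<otimes>\<^bsub>free_algebra S\<^esub> y = x * y" "x \<oplus>\<^bsub>free_algebra S\<^esub> y = x + y"
  "\<one>\<^bsub>free_algebra S\<^esub> = 1" "\<zero>\<^bsub>free_algebra S\<^esub> = 0"
  by (simp_all add: free_algebra_def)

lemma ring_free_algebra: "ring (free_algebra S)"
proof (rule ringI)
  show "abelian_group (free_algebra S)"
  proof (rule abelian_groupI)
    fix x assume "x \<in> free_alg_on S"
    then show "\<exists>y\<in>free_alg_on S. y \<oplus>\<^bsub>free_algebra S\<^esub> x = \<zero>\<^bsub>free_algebra S\<^esub>"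
      by (intro bexI[of _ "- x"]) (simp_all add: free_alg_on_uminus)
  qed (simp_all add: free_alg_on_add add_ac)
  show "monoid (free_algebra S)"
    by (rule monoidI) (simp_all add: free_alg_on_mult mult.assoc)
qed (simp_all add: distrib_left distrib_right)

lemma a_inv_free_algebra: "f \<in> free_alg_on S \<Longrightarrow> \<ominus>\<^bsub>free_algebra S\<^esub> f = - f"
  by (rule abelian_group.minus_equality[OF ring.is_abelian_group[OF ring_free_algebra]])
    (simp_all add: free_alg_on_uminus)

lemma ideal_free_algebraI:
  assumes "J \<subseteq> free_alg_on S" "0 \<in> J"
    and "\<And>f g. f \<in> J \<Longrightarrow> g \<in> J \<Longrightarrow> f + g \<in> J" and "\<And>f. f \<in> J \<Longrightarrow> - f \<in> J"
    and "\<And>f h. f \<in> J \<Longrightarrow> h \<in> free_alg_on S \<Longrightarrow> h * f \<in> J"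
    and "\<And>f h. f \<in> J \<Longrightarrow> h \<in> free_alg_on S \<Longrightarrow> f * h \<in> J"
  shows "ideal J (free_algebra S)"
proof (rule idealI[OF ring_free_algebra])
  show "subgroup J (add_monoid (free_algebra S))"
  proof
    fix x assume "x \<in> J"
    moreover from this have "inv\<^bsub>add_monoid (free_algebra S)\<^esub> x = - x"
      using a_inv_free_algebra[of x S] assms(1) by (auto simp: a_inv_def)
    ultimately show "inv\<^bsub>add_monoid (free_algebra S)\<^esub> x \<in> J"
      using assms(4) by simp
  qed (use assms in auto)
qed (use assms in auto)

locale matrix_lie_algebra =
  fixes g :: "complex mat set"
  assumes add_closed: "x \<in> g \<Longrightarrow> y \<in> g \<Longrightarrow> x + y \<in> g"
    and smult_closed: "x \<in> g \<Longrightarrow> c \<cdot>\<^sub>m x \<in> g"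
    and bracket_closed: "x \<in> g \<Longrightarrow> y \<in> g \<Longrightarrow> x * y - y * x \<in> g"
begin

lemma uea_rels_subset: "uea_rels g \<subseteq> free_alg_on g"
  unfolding uea_rels_def
  by (auto intro!: free_alg_on_intros add_closed smult_closed bracket_closed)

lemma ideal_uea_ideal: "ideal (uea_ideal g) (free_algebra g)"
  unfolding uea_ideal_def by (rule ring.genideal_ideal[OF ring_free_algebra uea_rels_subset])

sublocale uea: ideal "uea_ideal g" "free_algebra g"
  by (rule ideal_uea_ideal)

lemma uea_rels_in_ideal: "uea_rels g \<subseteq> uea_ideal g"
  unfolding uea_ideal_def by (rule ring.genideal_self[OF ring_free_algebra uea_rels_subset])

lemma uea_ideal_minimal: "ideal J (free_algebra g) \<Longrightarrow> uea_rels g \<subseteq> J \<Longrightarrow> uea_ideal g \<subseteq> J"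
  unfolding uea_ideal_def by (rule ring.genideal_minimal[OF ring_free_algebra])

lemma uea_ideal_subset: "f \<in> uea_ideal g \<Longrightarrow> f \<in> free_alg_on g"
  by (rule uea.a_Hcarr)

lemma uea_ideal_0 [simp]: "0 \<in> uea_ideal g"
  using additive_subgroup.zero_closed[OF uea.additive_subgroup_axioms] by simp

lemma uea_ideal_add: "f \<in> uea_ideal g \<Longrightarrow> h \<in> uea_ideal g \<Longrightarrow> f + h \<in> uea_ideal g"
  using additive_subgroup.a_closed[OF uea.additive_subgroup_axioms] by simp

lemma uea_ideal_uminus: "f \<in> uea_ideal g \<Longrightarrow> - f \<in> uea_ideal g"
  using additive_subgroup.a_inv_closed[OF uea.additive_subgroup_axioms, of f] by (simp add: a_inv_free_algebra uea_ideal_subset)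

lemma uea_ideal_diff: "f \<in> uea_ideal g \<Longrightarrow> h \<in> uea_ideal g \<Longrightarrow> f - h \<in> uea_ideal g"
  using uea_ideal_add[OF _ uea_ideal_uminus] by fastforce

lemma uea_ideal_mult_left: "f \<in> uea_ideal g \<Longrightarrow> h \<in> free_alg_on g \<Longrightarrow> h * f \<in> uea_ideal g"
  using uea.I_l_closed by simp

lemma uea_ideal_mult_right: "f \<in> uea_ideal g \<Longrightarrow> h \<in> free_alg_on g \<Longrightarrow> f * h \<in> uea_ideal g"
  using uea.I_r_closed by simp

lemma gen_add_rel: "x \<in> g \<Longrightarrow> y \<in> g \<Longrightarrow> gen (x + y) - gen x - gen y \<in> uea_ideal g"
  and gen_smult_rel: "x \<in> g \<Longrightarrow> gen (c \<cdot>\<^sub>m x) - scal c * gen x \<in> uea_ideal g"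
  and gen_bracket_rel:
    "x \<in> g \<Longrightarrow> y \<in> g \<Longrightarrow> gen x * gen y - gen y * gen x - gen (x * y - y * x) \<in> uea_ideal g"
  by (rule subsetD[OF uea_rels_in_ideal], unfold uea_rels_def, blast)+

text \<open>
  From here on, classes in the enveloping algebra are replaced by membership of differences in the
  ideal, which is stated with the ring operations of the type of the free algebra.
\<close>

lemma mem_uea_class_iff: "f' \<in> uea_class g f \<longleftrightarrow> f' - f \<in> uea_ideal g"
proof -
  have "f' \<in> uea_class g f \<longleftrightarrow> (\<exists>i\<in>uea_ideal g. f' = i + f)"
    by (auto simp: uea_class_def a_r_coset_def r_coset_def)
  also have "\<dots> \<longleftrightarrow> f' - f \<in> uea_ideal g"
    by (metis add_diff_cancel_right' diff_add_cancel)
  finally show ?thesis .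
qed

lemma uea_class_eq_iff: "uea_class g f = uea_class g f' \<longleftrightarrow> f - f' \<in> uea_ideal g"
proof
  assume "uea_class g f = uea_class g f'"
  then show "f - f' \<in> uea_ideal g"
    using mem_uea_class_iff[of f f] mem_uea_class_iff[of f f'] by simp
next
  assume *: "f - f' \<in> uea_ideal g"
  have "h - f \<in> uea_ideal g \<longleftrightarrow> h - f' \<in> uea_ideal g" for h
    using uea_ideal_add[OF _ *, of "h - f"] uea_ideal_diff[OF _ *, of "h - f'"] by auto
  then show "uea_class g f = uea_class g f'"
    by (auto simp: mem_uea_class_iff)
qed

lemma carrier_uea: "carrier (uea g) = uea_class g ` free_alg_on g"
  by (auto simp: uea_def FactRing_def A_RCOSETS_def RCOSETS_def uea_class_def a_r_coset_def)

lemma uea_class_add: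
  "f \<in> free_alg_on g \<Longrightarrow> h \<in> free_alg_on g \<Longrightarrow>
    uea_class g f \<oplus>\<^bsub>uea g\<^esub> uea_class g h = uea_class g (f + h)"
  using uea.a_rcos_sum[of f h] by (simp add: uea_def FactRing_def uea_class_def)

lemma uea_class_mult:
  "f \<in> free_alg_on g \<Longrightarrow> h \<in> free_alg_on g \<Longrightarrow>
    uea_class g f \<otimes>\<^bsub>uea g\<^esub> uea_class g h = uea_class g (f * h)"
  using uea.rcoset_mult_add[of f h] by (simp add: uea_def FactRing_def uea_class_def)

end

section \<open>Modules induced from a character\<close>

text \<open>
  The function \<open>\<rho>\<close> enters the tensor product, while computations use the linear form \<open>\<chi>\<close> by which it
  acts on \<open>p\<close>. For an action on a line, compatibility with brackets means that \<open>\<chi>\<close> vanishes on them.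
\<close>

locale induced_character = g: matrix_lie_algebra g + p: matrix_lie_algebra p
  for g p :: "complex mat set" +
  fixes \<rho> :: "complex mat \<Rightarrow> complex \<Rightarrow> complex" and \<chi> :: "complex mat \<Rightarrow> complex"
  assumes sub: "p \<subseteq> g"
    and \<rho>_eq: "x \<in> p \<Longrightarrow> \<rho> x v = \<chi> x * v"
    and \<chi>_add: "x \<in> p \<Longrightarrow> y \<in> p \<Longrightarrow> \<chi> (x + y) = \<chi> x + \<chi> y"
    and \<chi>_smult: "x \<in> p \<Longrightarrow> \<chi> (c \<cdot>\<^sub>m x) = c * \<chi> x"
    and \<chi>_bracket: "x \<in> p \<Longrightarrow> y \<in> p \<Longrightarrow> \<chi> (x * y - y * x) = 0"
begin

definition \<chi>\<^sub>f :: "complex mat free_alg \<Rightarrow> complex" where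
  "\<chi>\<^sub>f = linext (\<lambda>w. prod_list (map \<chi> w))"

lemma \<chi>\<^sub>f_simps [simp]:
  "\<chi>\<^sub>f 0 = 0" "\<chi>\<^sub>f (f + h) = \<chi>\<^sub>f f + \<chi>\<^sub>f h" "\<chi>\<^sub>f (f - h) = \<chi>\<^sub>f f - \<chi>\<^sub>f h" "\<chi>\<^sub>f (- f) = - \<chi>\<^sub>f f"
  "\<chi>\<^sub>f (scal c) = c" "\<chi>\<^sub>f (gen x) = \<chi> x" "\<chi>\<^sub>f (f * h) = \<chi>\<^sub>f f * \<chi>\<^sub>f h"
  by (simp_all add: \<chi>\<^sub>f_def scal_def gen_def linext_multiplicative)

lemma \<chi>\<^sub>f_ideal: "f \<in> uea_ideal p \<Longrightarrow> \<chi>\<^sub>f f = 0"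
proof -
  have "uea_ideal p \<subseteq> {f \<in> free_alg_on p. \<chi>\<^sub>f f = 0}"
  proof (rule p.uea_ideal_minimal)
    show "ideal {f \<in> free_alg_on p. \<chi>\<^sub>f f = 0} (free_algebra p)"
      by (rule ideal_free_algebraI) (auto intro: free_alg_on_intros free_alg_on_uminus)
    show "uea_rels p \<subseteq> {f \<in> free_alg_on p. \<chi>\<^sub>f f = 0}"
    proof
      fix f assume f: "f \<in> uea_rels p"
      then have "\<chi>\<^sub>f f = 0"
        unfolding uea_rels_def by (auto simp: \<chi>_add \<chi>_smult \<chi>_bracket)
      then show "f \<in> {f \<in> free_alg_on p. \<chi>\<^sub>f f = 0}"
        using f p.uea_rels_subset by blast
    qed
  qed
  then show "f \<in> uea_ideal p \<Longrightarrow> \<chi>\<^sub>f f = 0" by auto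
qed

lemma free_action_\<rho>: "f \<in> free_alg_on p \<Longrightarrow> free_action \<rho> f v = \<chi>\<^sub>f f * v"
proof -
  assume f: "f \<in> free_alg_on p"
  have "foldr \<rho> w v = prod_list (map \<chi> w) * v" if "set w \<subseteq> p" for w
    using that by (induction w) (auto simp: \<rho>_eq)
  then have "free_action \<rho> f v = linext (\<lambda>w. prod_list (map \<chi> w) * v) f"
    using f unfolding free_action_def linext_def[symmetric]
    by (intro linext_cong) (auto simp: free_alg_on_iff)
  then show ?thesis by (simp add: \<chi>\<^sub>f_def linext_mult_fun_right)
qed

lemma uea_action_class:
  assumes "f \<in> free_alg_on p"
  shows "uea_action \<rho> (uea_class p f) v = \<chi>\<^sub>f f * v"
proof -
  have "free_action \<rho> f' v = \<chi>\<^sub>f f * v" if "f' \<in> uea_class p f" for f'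
  proof -
    have i: "f' - f \<in> uea_ideal p" using that by (simp add: p.mem_uea_class_iff)
    then have "f' \<in> free_alg_on p"
      using free_alg_on_add[OF p.uea_ideal_subset assms] by fastforce
    then show ?thesis using \<chi>\<^sub>f_ideal[OF i] by (simp add: free_action_\<rho>)
  qed
  moreover have "f \<in> uea_class p f" by (simp add: p.mem_uea_class_iff)
  ultimately have "(\<lambda>f. free_action \<rho> f v) ` uea_class p f = {\<chi>\<^sub>f f * v}"
    by (auto simp: image_def)
  then show ?thesis by (simp add: uea_action_def)
qed

text \<open>
  The intersection of the ideal of \<open>g\<close> with the free algebra on \<open>p\<close> is an ideal containing the
  relations of \<open>p\<close>; this makes the canonical map between the enveloping algebras well-defined.
\<close>

lemma uea_ideal_mono: "f \<in> uea_ideal p \<Longrightarrow> f \<in> uea_ideal g"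
proof -
  have "uea_ideal p \<subseteq> uea_ideal g \<inter> free_alg_on p"
  proof (rule p.uea_ideal_minimal)
    show "ideal (uea_ideal g \<inter> free_alg_on p) (free_algebra p)"
      by (rule ideal_free_algebraI)
        (auto intro: free_alg_on_intros free_alg_on_uminus free_alg_on_mono[OF sub]
          g.uea_ideal_add g.uea_ideal_uminus g.uea_ideal_mult_left g.uea_ideal_mult_right)
    have "uea_rels p \<subseteq> uea_rels g" using sub unfolding uea_rels_def by blast
    then show "uea_rels p \<subseteq> uea_ideal g \<inter> free_alg_on p"
      using p.uea_rels_subset g.uea_rels_in_ideal by blast
  qed
  then show "f \<in> uea_ideal p \<Longrightarrow> f \<in> uea_ideal g" by auto
qed

lemma uea_map_class: "f \<in> free_alg_on p \<Longrightarrow> uea_map g (uea_class p f) = uea_class g f"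
proof -
  have "h \<in> uea_map g (uea_class p f) \<longleftrightarrow> h \<in> uea_class g f" for h
  proof
    assume "h \<in> uea_map g (uea_class p f)"
    then obtain i f' where *: "i \<in> uea_ideal g" "f' - f \<in> uea_ideal p" "h = i + f'"
      by (auto simp: uea_map_def set_add_def set_mult_def p.mem_uea_class_iff)
    then have "i + (f' - f) \<in> uea_ideal g"
      using g.uea_ideal_add uea_ideal_mono by blast
    then show "h \<in> uea_class g f"
      using * by (simp add: g.mem_uea_class_iff add_diff_eq)
  next
    assume "h \<in> uea_class g f"
    then have i: "h - f \<in> uea_ideal g" by (simp add: g.mem_uea_class_iff)
    have f: "f \<in> uea_class p f" by (simp add: p.mem_uea_class_iff)
    have "(h - f) \<oplus>\<^bsub>free_algebra g\<^esub> f \<in> uea_map g (uea_class p f)"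
      unfolding uea_map_def set_add_def' by (rule UN_I[OF i UN_I[OF f singletonI]])
    then show "h \<in> uea_map g (uea_class p f)" by simp
  qed
  then show ?thesis by blast
qed

abbreviation "K \<equiv> ind_kernel g p \<rho>"
abbreviation "FG \<equiv> ind_free_group g"
abbreviation "M \<equiv> ind_module g p \<rho>"

lemma group_FG: "group FG" and comm_group_FG: "comm_group FG"
  by (simp_all add: ind_free_group_def abelian_free_Abelian_group)

lemma carrier_FG: "X \<in> carrier FG \<longleftrightarrow> Poly_Mapping.keys X \<subseteq> carrier (uea g) \<times> UNIV"
  by (simp add: ind_free_group_def)

lemma FG_simps [simp]: "X \<otimes>\<^bsub>FG\<^esub> Y = X + Y" "\<one>\<^bsub>FG\<^esub> = 0"
  by (simp_all add: ind_free_group_def)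

lemma inv_FG [simp]: "X \<in> carrier FG \<Longrightarrow> inv\<^bsub>FG\<^esub> X = - X"
  by (simp add: ind_free_group_def)

lemma FG_closed:
  "X \<in> carrier FG \<Longrightarrow> Y \<in> carrier FG \<Longrightarrow> X + Y \<in> carrier FG"
  "X \<in> carrier FG \<Longrightarrow> Y \<in> carrier FG \<Longrightarrow> X - Y \<in> carrier FG"
  "f \<in> free_alg_on g \<Longrightarrow> frag_of (uea_class g f, v) \<in> carrier FG"
  using Poly_Mapping.keys_add[of X Y] keys_diff[of X Y]
  by (auto simp: carrier_FG g.carrier_uea)

text \<open>
  The three families of relations of the tensor product, written with representatives in the free
  algebra in place of classes.
\<close>

definition ind_rel_add_left :: "complex mat free_alg \<Rightarrow> complex mat free_alg \<Rightarrow> complex \<Rightarrow> ind_free" where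
  "ind_rel_add_left f f' v = frag_of (uea_class g (f + f'), v) - frag_of (uea_class g f, v) - frag_of (uea_class g f', v)"

definition ind_rel_add_right :: "complex mat free_alg \<Rightarrow> complex \<Rightarrow> complex \<Rightarrow> ind_free" where
  "ind_rel_add_right f v v' = frag_of (uea_class g f, v + v') - frag_of (uea_class g f, v) - frag_of (uea_class g f, v')"

definition ind_rel_mult :: "complex mat free_alg \<Rightarrow> complex mat free_alg \<Rightarrow> complex \<Rightarrow> ind_free" where
  "ind_rel_mult f r v = frag_of (uea_class g (f * r), v) - frag_of (uea_class g f, \<chi>\<^sub>f r * v)"

lemma ind_rels_cases [consumes 1, case_names add_left add_right mult]:
  assumes "X \<in> ind_rels g p \<rho>"
  obtains f f' v where "f \<in> free_alg_on g" "f' \<in> free_alg_on g" "X = ind_rel_add_left f f' v"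
  | f v v' where "f \<in> free_alg_on g" "X = ind_rel_add_right f v v'"
  | f r v where "f \<in> free_alg_on g" "r \<in> free_alg_on p" "X = ind_rel_mult f r v"
  using assms unfolding ind_rels_def ind_rel_add_left_def ind_rel_add_right_def ind_rel_mult_def
  by (auto simp: g.carrier_uea p.carrier_uea g.uea_class_add uea_map_class uea_action_class
      g.uea_class_mult free_alg_on_mono[OF sub])

lemma ind_rels_intros:
  "f \<in> free_alg_on g \<Longrightarrow> f' \<in> free_alg_on g \<Longrightarrow> ind_rel_add_left f f' v \<in> ind_rels g p \<rho>"
  "f \<in> free_alg_on g \<Longrightarrow> ind_rel_add_right f v v' \<in> ind_rels g p \<rho>"
  "f \<in> free_alg_on g \<Longrightarrow> r \<in> free_alg_on p \<Longrightarrow> ind_rel_mult f r v \<in> ind_rels g p \<rho>"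
proof -
  show "ind_rel_add_left f f' v \<in> ind_rels g p \<rho>" if "f \<in> free_alg_on g" "f' \<in> free_alg_on g"
  proof -
    have "uea_class g f \<in> carrier (uea g)" "uea_class g f' \<in> carrier (uea g)"
      using that by (auto simp: g.carrier_uea)
    then show ?thesis
      using that unfolding ind_rels_def ind_rel_add_left_def
      by (subst g.uea_class_add[symmetric]) blast+
  qed
  show "ind_rel_add_right f v v' \<in> ind_rels g p \<rho>" if "f \<in> free_alg_on g"
  proof -
    have "uea_class g f \<in> carrier (uea g)"
      using that by (auto simp: g.carrier_uea)
    then show ?thesis
      unfolding ind_rels_def ind_rel_add_right_def by blast
  qed
  show "ind_rel_mult f r v \<in> ind_rels g p \<rho>" if "f \<in> free_alg_on g" "r \<in> free_alg_on p"
  proof -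
    have "uea_class g f \<in> carrier (uea g)" "uea_class p r \<in> carrier (uea p)"
      using that by (auto simp: g.carrier_uea p.carrier_uea)
    moreover have "ind_rel_mult f r v =
        frag_of (uea_class g f \<otimes>\<^bsub>uea g\<^esub> uea_map g (uea_class p r), v) -
        frag_of (uea_class g f, uea_action \<rho> (uea_class p r) v)"
      using that by (simp add: ind_rel_mult_def uea_map_class uea_action_class g.uea_class_mult
          free_alg_on_mono[OF sub])
    ultimately show ?thesis
      unfolding ind_rels_def by blast
  qed
qed

lemma ind_rels_subset: "ind_rels g p \<rho> \<subseteq> carrier FG"
proof
  fix X assume "X \<in> ind_rels g p \<rho>"
  then show "X \<in> carrier FG"
    by (cases rule: ind_rels_cases)
      (simp_all add: ind_rel_add_left_def ind_rel_add_right_def ind_rel_mult_def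
        FG_closed free_alg_on_add free_alg_on_mult free_alg_on_mono[OF sub])
qed

lemma subgroup_K: "subgroup K FG"
  unfolding ind_kernel_def by (rule group.generate_is_subgroup[OF group_FG ind_rels_subset])

lemma normal_K: "K \<lhd> FG"
  by (rule comm_group.subgroup_imp_normal[OF comm_group_FG subgroup_K])

lemma K_carrier: "X \<in> K \<Longrightarrow> X \<in> carrier FG"
  using subgroup.mem_carrier[OF subgroup_K] .

lemma K_0: "0 \<in> K"
  using subgroup.one_closed[OF subgroup_K] by simp

lemma K_add: "X \<in> K \<Longrightarrow> Y \<in> K \<Longrightarrow> X + Y \<in> K"
  using subgroup.m_closed[OF subgroup_K] by simp

lemma K_uminus: "X \<in> K \<Longrightarrow> - X \<in> K"
  using subgroup.m_inv_closed[OF subgroup_K] by (simp add: K_carrier)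

lemma K_diff: "X \<in> K \<Longrightarrow> Y \<in> K \<Longrightarrow> X - Y \<in> K"
  using K_add[OF _ K_uminus] by fastforce

lemma K_rel: "X \<in> ind_rels g p \<rho> \<Longrightarrow> X \<in> K"
  unfolding ind_kernel_def by (rule generate.incl)

lemma mem_coset_iff: "Y \<in> K #>\<^bsub>FG\<^esub> X \<longleftrightarrow> Y - X \<in> K"
proof -
  have "Y \<in> K #>\<^bsub>FG\<^esub> X \<longleftrightarrow> (\<exists>k\<in>K. Y = k + X)"
    by (auto simp: r_coset_def)
  then show ?thesis
    by (metis add_diff_cancel_right' diff_add_cancel)
qed

lemma coset_eq_iff: "K #>\<^bsub>FG\<^esub> X = K #>\<^bsub>FG\<^esub> Y \<longleftrightarrow> X - Y \<in> K"
proof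
  assume "K #>\<^bsub>FG\<^esub> X = K #>\<^bsub>FG\<^esub> Y"
  then show "X - Y \<in> K"
    using mem_coset_iff[of X X] mem_coset_iff[of X Y] K_0 by simp
next
  assume *: "X - Y \<in> K"
  have "Z - X \<in> K \<longleftrightarrow> Z - Y \<in> K" for Z
    using K_add[OF _ *, of "Z - X"] K_diff[OF _ *, of "Z - Y"] by auto
  then show "K #>\<^bsub>FG\<^esub> X = K #>\<^bsub>FG\<^esub> Y"
    by (auto simp: mem_coset_iff)
qed

lemma one_M: "\<one>\<^bsub>M\<^esub> = K"
  by (simp add: ind_module_def FactGroup_def)

lemma coset_eq_one_iff: "K #>\<^bsub>FG\<^esub> X = \<one>\<^bsub>M\<^esub> \<longleftrightarrow> X \<in> K"
  using coset_eq_iff[of X 0] by (simp add: one_M r_coset_def)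

lemma carrier_M: "carrier M = (\<lambda>X. K #>\<^bsub>FG\<^esub> X) ` carrier FG"
  by (auto simp: ind_module_def FactGroup_def RCOSETS_def)

lemma mult_M:
  "X \<in> carrier FG \<Longrightarrow> Y \<in> carrier FG \<Longrightarrow>
    (K #>\<^bsub>FG\<^esub> X) \<otimes>\<^bsub>M\<^esub> (K #>\<^bsub>FG\<^esub> Y) = K #>\<^bsub>FG\<^esub> (X + Y)"
  using normal.rcos_sum[OF normal_K, of X Y] by (simp add: ind_module_def FactGroup_def)

lemma group_M: "group M"
  unfolding ind_module_def by (rule normal.factorgroup_is_group[OF normal_K])

text \<open>
  The vector \<open>[f] \<otimes> 1\<close>. Since \<open>u \<otimes> v = u v \<otimes> 1\<close> for a scalar \<open>v\<close>, vectors of this form exhaust the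
  module.
\<close>

definition ind_vec :: "complex mat free_alg \<Rightarrow> ind_free set" where
  "ind_vec f = K #>\<^bsub>FG\<^esub> frag_of (uea_class g f, 1)"

lemma ind_vec_add:
  assumes "f \<in> free_alg_on g" "h \<in> free_alg_on g"
  shows "ind_vec (f + h) = ind_vec f \<otimes>\<^bsub>M\<^esub> ind_vec h"
  using K_rel[OF ind_rels_intros(1)[OF assms, of 1]] assms
  by (simp add: ind_vec_def mult_M FG_closed coset_eq_iff ind_rel_add_left_def diff_diff_eq)

lemma ind_vec_carrier: "f \<in> free_alg_on g \<Longrightarrow> ind_vec f \<in> carrier M"
  by (auto simp: ind_vec_def carrier_M intro!: imageI FG_closed)

lemma ind_vec_eq_one_ideal: "f \<in> uea_ideal g \<Longrightarrow> ind_vec f = \<one>\<^bsub>M\<^esub>"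
proof -
  assume "f \<in> uea_ideal g"
  then have "uea_class g f = uea_class g 0"
    by (simp add: g.uea_class_eq_iff)
  moreover have "ind_rel_add_left 0 0 1 \<in> K"
    by (rule K_rel[OF ind_rels_intros(1)]) simp_all
  then have "- ind_rel_add_left 0 0 1 \<in> K" by (rule K_uminus)
  ultimately show ?thesis
    by (simp add: ind_vec_def coset_eq_one_iff ind_rel_add_left_def)
qed

lemma ind_vec_0: "ind_vec 0 = \<one>\<^bsub>M\<^esub>"
  by (rule ind_vec_eq_one_ideal) simp

lemma ind_vec_uminus: "f \<in> free_alg_on g \<Longrightarrow> ind_vec (- f) = inv\<^bsub>M\<^esub> ind_vec f"
  using ind_vec_add[of "- f" f]
  by (intro group.inv_equality[OF group_M, symmetric])
    (auto simp: ind_vec_0 ind_vec_carrier free_alg_on_uminus)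

lemma ind_vec_char:
  assumes "r \<in> free_alg_on p"
  shows "ind_vec (r - scal (\<chi>\<^sub>f r)) = \<one>\<^bsub>M\<^esub>"
proof -
  let ?r = "r - scal (\<chi>\<^sub>f r)"
  have "?r \<in> free_alg_on p" using assms by (intro free_alg_on_intros)
  then have 1: "ind_rel_mult 1 ?r 1 \<in> K"
    by (intro K_rel ind_rels_intros) auto
  have 2: "ind_rel_add_right 1 0 0 \<in> K"
    by (intro K_rel ind_rels_intros) auto
  show ?thesis
    using K_diff[OF 1 2] by (simp add: ind_vec_def coset_eq_one_iff ind_rel_mult_def ind_rel_add_right_def)
qed

lemma ind_vec_surj:
  assumes "m \<in> carrier M"
  obtains f where "f \<in> free_alg_on g" "m = ind_vec f"
proof -
  obtain X where X: "X \<in> carrier FG" "m = K #>\<^bsub>FG\<^esub> X"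
    using assms by (auto simp: carrier_M)
  have "\<exists>f\<in>free_alg_on g. X - frag_of (uea_class g f, 1) \<in> K"
    using X(1) unfolding carrier_FG
  proof (induction rule: frag_induction)
    case zero
    have "ind_vec 0 = \<one>\<^bsub>M\<^esub>" by (rule ind_vec_0)
    then have "frag_of (uea_class g 0, 1) \<in> K" by (simp add: ind_vec_def coset_eq_one_iff)
    then show ?case using K_uminus by (intro bexI[of _ 0]) force+
  next
    case (one x)
    then obtain f v where f: "f \<in> free_alg_on g" "x = (uea_class g f, v)"
      by (auto simp: g.carrier_uea)
    have "ind_rel_mult f (scal v) 1 \<in> K"
      using f by (intro K_rel ind_rels_intros) auto
    then have "- ind_rel_mult f (scal v) 1 \<in> K" by (rule K_uminus)
    then show ?case
      using f by (intro bexI[of _ "f * scal v"]) (auto simp: ind_rel_mult_def intro: free_alg_on_intros)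
  next
    case (diff a b)
    then obtain f h where fh: "f \<in> free_alg_on g" "h \<in> free_alg_on g"
      "a - frag_of (uea_class g f, 1) \<in> K" "b - frag_of (uea_class g h, 1) \<in> K"
      by blast
    have "ind_rel_add_left (f - h) h 1 \<in> K"
      using fh by (intro K_rel ind_rels_intros free_alg_on_intros)
    from K_add[OF K_diff[OF fh(3,4)] this]
    show ?case
      using fh by (intro bexI[of _ "f - h"]) (auto simp: ind_rel_add_left_def algebra_simps intro: free_alg_on_intros)
  qed
  then obtain f where "f \<in> free_alg_on g" "X - frag_of (uea_class g f, 1) \<in> K" by blast
  then show ?thesis
    using that X(2) by (simp add: ind_vec_def coset_eq_iff)
qed

text \<open>
  Left multiplication by \<open>[h]\<close> on the free abelian group maps each family of tensor relations to itself,
  hence preserves the kernel, and so acts on cosets through representatives.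
\<close>

lemma ind_action_vec:
  assumes h: "h \<in> free_alg_on g" and f: "f \<in> free_alg_on g"
  shows "ind_action g p \<rho> (uea_class g h) (ind_vec f) = ind_vec (h * f)"
proof -
  let ?e = "frag_extend (\<lambda>(u, v). frag_of (uea_class g h \<otimes>\<^bsub>uea g\<^esub> u, v))"
  have e_rel: "?e X \<in> ind_rels g p \<rho>" if "X \<in> ind_rels g p \<rho>" for X
    using that
  proof (cases rule: ind_rels_cases)
    case (add_left f f' v)
    then have "?e X = ind_rel_add_left (h * f) (h * f') v"
      using h by (simp add: ind_rel_add_left_def frag_extend_diff g.uea_class_mult free_alg_on_add distrib_left)
    then show ?thesis using add_left h by (auto intro!: ind_rels_intros free_alg_on_intros)
  next
    case (add_right f v v')
    then have "?e X = ind_rel_add_right (h * f) v v'"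
      using h by (simp add: ind_rel_add_right_def frag_extend_diff g.uea_class_mult)
    then show ?thesis using add_right h by (auto intro!: ind_rels_intros free_alg_on_intros)
  next
    case (mult f r v)
    then have "?e X = ind_rel_mult (h * f) r v"
      using h by (simp add: ind_rel_mult_def frag_extend_diff g.uea_class_mult free_alg_on_mult
          free_alg_on_mono[OF sub] mult.assoc)
    then show ?thesis using mult h by (auto intro!: ind_rels_intros free_alg_on_intros)
  qed
  have e_K: "?e X \<in> K" if "X \<in> K" for X
    using that unfolding ind_kernel_def
  proof induction
    case one
    then show ?case using K_0 by (simp add: ind_kernel_def)
  next
    case (incl X)
    then show ?case using e_rel by (intro generate.incl)
  next
    case (inv X)
    have "?e X \<in> K" using K_rel[OF e_rel[OF inv]] .
    moreover have "X \<in> carrier FG" using inv ind_rels_subset by blast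
    ultimately have "?e (inv\<^bsub>FG\<^esub> X) \<in> K" using K_uminus by (simp add: frag_extend_minus)
    then show ?case by (simp add: ind_kernel_def)
  next
    case (eng X Y)
    then show ?case using K_add by (simp add: ind_kernel_def frag_extend_add)
  qed
  let ?X = "frag_of (uea_class g f, 1)" and ?Y = "frag_of (uea_class g (h * f), 1)"
  have eX: "?e ?X = ?Y" using h f by (simp add: g.uea_class_mult)
  \<comment> \<open>adding the kernel to the image of the coset of \<open>?X\<close> gives the full coset of its image \<open>?Y\<close>\<close>
  have "Z \<in> K <#>\<^bsub>FG\<^esub> ?e ` (K #>\<^bsub>FG\<^esub> ?X) \<longleftrightarrow> Z - ?Y \<in> K" for Z
  proof
    assume "Z \<in> K <#>\<^bsub>FG\<^esub> ?e ` (K #>\<^bsub>FG\<^esub> ?X)"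
    then obtain k k' where "k \<in> K" "k' \<in> K" "Z = k + ?e (k' + ?X)"
      by (auto simp: set_mult_def r_coset_def)
    moreover have "?e (k' + ?X) = ?e k' + ?Y" by (simp only: frag_extend_add eX)
    ultimately show "Z - ?Y \<in> K"
      using K_add[OF _ e_K, of k k'] by (simp add: add.assoc[symmetric])
  next
    assume "Z - ?Y \<in> K"
    moreover have "?X \<in> K #>\<^bsub>FG\<^esub> ?X" by (simp add: mem_coset_iff K_0)
    ultimately have "(Z - ?Y) \<otimes>\<^bsub>FG\<^esub> ?e ?X \<in> K <#>\<^bsub>FG\<^esub> ?e ` (K #>\<^bsub>FG\<^esub> ?X)"
      unfolding set_mult_def by blast
    moreover have "(Z - ?Y) \<otimes>\<^bsub>FG\<^esub> ?e ?X = Z"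
      unfolding eX FG_simps by (rule diff_add_cancel)
    ultimately show "Z \<in> K <#>\<^bsub>FG\<^esub> ?e ` (K #>\<^bsub>FG\<^esub> ?X)"
      by (rule back_subst)
  qed
  note mem = this
  show ?thesis
    unfolding ind_action_def ind_vec_def by (rule Set.set_eqI) (simp only: mem mem_coset_iff)
qed

text \<open>
  The universal property of the induced module, for one scalar component \<open>e\<close> of a homomorphism: an
  additive function on the free algebra that vanishes on the ideal of \<open>g\<close> and transforms by the
  character under right multiplication with elements of \<open>p\<close> induces an additive function on the tensor
  product, which detects nonzero vectors.
\<close>

lemma ind_vec_eq_one_imp:
  fixes e :: "complex mat free_alg \<Rightarrow> complex"
  assumes add: "\<And>f h. e (f + h) = e f + e h"
    and ideal: "\<And>f. f \<in> uea_ideal g \<Longrightarrow> e f = 0"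
    and char: "\<And>f r. f \<in> free_alg_on g \<Longrightarrow> r \<in> free_alg_on p \<Longrightarrow> e (f * r) = \<chi>\<^sub>f r * e f"
    and f: "f \<in> free_alg_on g" "ind_vec f = \<one>\<^bsub>M\<^esub>"
  shows "e f = 0"
proof -
  define E where "E u = e (SOME f. f \<in> u)" for u
  have E: "E (uea_class g f) = e f" for f
  proof -
    have "f \<in> uea_class g f" by (simp add: g.mem_uea_class_iff)
    then have "(SOME f'. f' \<in> uea_class g f) \<in> uea_class g f" by (rule someI)
    then have "e ((SOME f'. f' \<in> uea_class g f) - f) = 0"
      by (intro ideal) (simp add: g.mem_uea_class_iff)
    with add[of "(SOME f'. f' \<in> uea_class g f) - f" f] show ?thesis
      by (simp add: E_def)
  qed
  let ?A = "\<lparr>carrier = UNIV, monoid.mult = (+), one = 0\<rparr> :: complex monoid"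
  have "comm_group ?A"
  proof (rule comm_groupI)
    fix x :: complex
    show "\<exists>y\<in>carrier ?A. y \<otimes>\<^bsub>?A\<^esub> x = \<one>\<^bsub>?A\<^esub>"
      by (intro bexI[of _ "- x"]) simp_all
  qed (simp_all add: add_ac)
  then obtain H where H: "H \<in> hom FG ?A"
    "\<And>x. x \<in> carrier (uea g) \<times> UNIV \<Longrightarrow> H (frag_of x) = (case x of (u, v) \<Rightarrow> v * E u)"
    using comm_group.free_Abelian_group_universal
      [of ?A "\<lambda>(u, v). v * E u" "carrier (uea g) \<times> (UNIV :: complex set)"]
    unfolding ind_free_group_def by (metis UNIV_I partial_object.select_convs(1) subsetI)
  have H_add: "H (X + Y) = H X + H Y" if "X \<in> carrier FG" "Y \<in> carrier FG" for X Y
    using hom_mult[OF H(1) that] by simp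
  have H_diff: "H (X - Y) = H X - H Y" if "X \<in> carrier FG" "Y \<in> carrier FG" for X Y
    using H_add[of "X - Y" Y] that by (simp add: FG_closed)
  have H_of: "H (frag_of (uea_class g f, v)) = v * e f" if "f \<in> free_alg_on g" for f v
    using H(2) that by (simp add: g.carrier_uea E)
  have H_rel: "H X = 0" if "X \<in> ind_rels g p \<rho>" for X
    using that
  proof (cases rule: ind_rels_cases)
    case (mult f r v)
    then show ?thesis
      by (simp add: ind_rel_mult_def H_diff H_of FG_closed free_alg_on_mult free_alg_on_mono[OF sub] char)
  qed (simp_all add: ind_rel_add_left_def ind_rel_add_right_def H_diff H_of FG_closed free_alg_on_add
      add distrib_left distrib_right)
  have "X \<in> carrier FG \<and> H X = 0" if "X \<in> K" for X
    using that unfolding ind_kernel_def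
  proof induction
    case one
    show ?case using H_diff[of 0 0] by (simp add: carrier_FG)
  next
    case (incl X)
    then show ?case using H_rel ind_rels_subset by blast
  next
    case (inv X)
    then have "X \<in> carrier FG" "H X = 0" using H_rel ind_rels_subset by blast+
    moreover have "0 \<in> carrier FG" by (simp add: carrier_FG)
    ultimately show ?case using H_diff[of 0 X] H_diff[of 0 0] FG_closed(2)[of 0 X] by simp
  next
    case (eng X Y)
    then show ?case by (simp add: H_add FG_closed)
  qed
  moreover have "frag_of (uea_class g f, 1) \<in> K"
    using f(2) by (simp add: ind_vec_def coset_eq_one_iff)
  ultimately have "H (frag_of (uea_class g f, 1)) = 0" by blast
  with f(1) show ?thesis by (simp add: H_of)
qed

end

section \<open>Differential operators with integral exponents\<close>

text \<open>
  The exponent \<open>a\<close> stands for the monomial with exponents \<open>a 1, \<dots>, a (n - 1)\<close> in the lowering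
  operators; on the polynomial submodule below, \<open>a 0\<close> is minus its degree.
\<close>

type_synonym exponent = "nat \<Rightarrow> int"
type_synonym laurent = "exponent \<Rightarrow> complex"

definition unit_exp :: "nat \<Rightarrow> exponent" (\<open>\<epsilon>\<close>) where
  "\<epsilon> i = (\<lambda>k. if k = i then 1 else 0)"

text \<open>
  The matrix unit \<open>E\<^sub>i\<^sub>,\<^sub>j\<close> sends the monomial with exponent \<open>a\<close> to \<open>coef s i j a\<close> times the monomial with
  exponent \<open>a + \<epsilon> i - \<epsilon> j\<close>. For generic \<open>s\<close>, up to a rescaling of the monomials by a factor that
  depends on \<open>a 0\<close>, this is the action of \<open>x\<^sub>i \<partial>/\<partial>x\<^sub>j\<close> on monomials in \<open>x\<^sub>0, \<dots>, x\<^bsub>n - 1\<^esub>\<close> in which \<open>x\<^sub>0\<close> has the exponent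
  \<open>s + a 0\<close>; the rescaling gives the lowering operators the coefficient \<open>1\<close>.
\<close>

definition coef :: "complex \<Rightarrow> nat \<Rightarrow> nat \<Rightarrow> exponent \<Rightarrow> complex" where
  "coef s i j a =
    (if j = 0 then (if i = 0 then s + of_int (a 0) else 1)
     else if i = 0 then of_int (a j) * (s + of_int (a 0) + 1)
     else of_int (a j))"

text \<open>
  The functions are the coefficient families of formal sums of monomials: the coefficient at \<open>a\<close>
  collects the contributions from the exponents \<open>a - \<epsilon> i + \<epsilon> j\<close>.
\<close>

definition dop :: "nat \<Rightarrow> complex \<Rightarrow> complex mat \<Rightarrow> laurent \<Rightarrow> laurent" where
  "dop n s A F = (\<lambda>a. \<Sum>i<n. \<Sum>j<n. A $$ (i, j) * (coef s i j (a - \<epsilon> i + \<epsilon> j) * F (a - \<epsilon> i + \<epsilon> j)))"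

definition delta :: "exponent \<Rightarrow> laurent" where
  "delta b = (\<lambda>a. if a = b then 1 else 0)"

text \<open>
  The coefficients of the commutator relations of the matrix units \<open>E\<^sub>i\<^sub>,\<^sub>j\<close> and \<open>E\<^sub>k\<^sub>,\<^sub>l\<close>. It is an identity
  between polynomials in \<open>s\<close> and the entries of \<open>a\<close>, hence valid for negative exponents as well.
\<close>

lemma coef_bracket:
  "coef s i j (a + \<epsilon> k - \<epsilon> l) * coef s k l a - coef s k l (a + \<epsilon> i - \<epsilon> j) * coef s i j a =
    (if j = k then coef s i l a else 0) - (if i = l then coef s k j a else 0)"
  by (cases "i = 0"; cases "j = 0"; cases "k = 0"; cases "l = 0")
    (simp_all add: coef_def unit_exp_def algebra_simps)

lemma linear_op_dop: "linear_op (dop n s A)"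
  by (simp add: linear_op_def dop_def fun_eq_iff distrib_left sum.distrib sum_distrib_left mult_ac)

lemma dop_plus: "dop n s A (F + G) = dop n s A F + dop n s A G"
  and dop_mult: "dop n s A (\<lambda>a. c * F a) = (\<lambda>a. c * dop n s A F a)"
  using linear_op_dop[of n s A] by (auto simp: linear_op_def)

lemma dop_add_mat:
  "A \<in> carrier_mat n n \<Longrightarrow> B \<in> carrier_mat n n \<Longrightarrow> dop n s (A + B) F = dop n s A F + dop n s B F"
  by (simp add: dop_def fun_eq_iff distrib_right sum.distrib)

lemma dop_smult_mat:
  "A \<in> carrier_mat n n \<Longrightarrow> dop n s (c \<cdot>\<^sub>m A) F = (\<lambda>a. c * dop n s A F a)"
  by (simp add: dop_def fun_eq_iff sum_distrib_left mult.assoc)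

lemma mat_mult_entry:
  "A \<in> carrier_mat n n \<Longrightarrow> B \<in> carrier_mat n n \<Longrightarrow> i < n \<Longrightarrow> j < n \<Longrightarrow>
    (A * B) $$ (i, j) = (\<Sum>k<n. A $$ (i, k) * B $$ (k, j))"
  by (simp add: scalar_prod_def atLeast0LessThan)

text \<open>
  Both compositions are reindexed by the exponent \<open>a - \<epsilon> i + \<epsilon> j - \<epsilon> k + \<epsilon> l\<close> at which the function is
  finally evaluated. There the identity for the coefficients applies, and its two Kronecker symbols
  contract the fourfold sum to the entries of the two matrix products.
\<close>

lemma dop_bracket:
  assumes A: "A \<in> carrier_mat n n" and B: "B \<in> carrier_mat n n"
  shows "dop n s (A * B - B * A) F = dop n s A (dop n s B F) - dop n s B (dop n s A F)"
proof
  fix a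
  define h where "h i l = coef s i l (a - \<epsilon> i + \<epsilon> l) * F (a - \<epsilon> i + \<epsilon> l)" for i l
  let ?c = "\<lambda>i j k l. a - \<epsilon> i + \<epsilon> j - \<epsilon> k + \<epsilon> l"
  have AB: "dop n s A (dop n s B F) a =
      (\<Sum>i<n. \<Sum>j<n. \<Sum>k<n. \<Sum>l<n. A $$ (i, j) * B $$ (k, l) *
        (coef s i j (?c i j k l + \<epsilon> k - \<epsilon> l) * coef s k l (?c i j k l) * F (?c i j k l)))"
    unfolding dop_def sum_distrib_left
    by (intro sum.cong refl) (simp add: algebra_simps)
  have "dop n s B (dop n s A F) a =
      (\<Sum>k<n. \<Sum>l<n. \<Sum>i<n. \<Sum>j<n. A $$ (i, j) * B $$ (k, l) *
        (coef s k l (?c i j k l + \<epsilon> i - \<epsilon> j) * coef s i j (?c i j k l) * F (?c i j k l)))"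
    unfolding dop_def sum_distrib_left
    by (intro sum.cong refl) (simp add: algebra_simps)
  also have "\<dots> =
      (\<Sum>k<n. \<Sum>i<n. \<Sum>j<n. \<Sum>l<n. A $$ (i, j) * B $$ (k, l) *
        (coef s k l (?c i j k l + \<epsilon> i - \<epsilon> j) * coef s i j (?c i j k l) * F (?c i j k l)))"
    by (rule sum.cong[OF refl], rule trans[OF sum.swap], rule sum.cong[OF refl sum.swap])
  also have "\<dots> =
      (\<Sum>i<n. \<Sum>j<n. \<Sum>k<n. \<Sum>l<n. A $$ (i, j) * B $$ (k, l) *
        (coef s k l (?c i j k l + \<epsilon> i - \<epsilon> j) * coef s i j (?c i j k l) * F (?c i j k l)))"
    by (rule trans[OF sum.swap], rule sum.cong[OF refl sum.swap])
  finally have BA: "dop n s B (dop n s A F) a = \<dots>" .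
  have "dop n s A (dop n s B F) a - dop n s B (dop n s A F) a =
      (\<Sum>i<n. \<Sum>j<n. \<Sum>k<n. \<Sum>l<n. A $$ (i, j) * B $$ (k, l) *
        ((coef s i j (?c i j k l + \<epsilon> k - \<epsilon> l) * coef s k l (?c i j k l) -
          coef s k l (?c i j k l + \<epsilon> i - \<epsilon> j) * coef s i j (?c i j k l)) * F (?c i j k l)))"
    unfolding AB BA sum_subtractf[symmetric]
    by (intro sum.cong refl) (simp add: algebra_simps)
  also have "\<dots> =
      (\<Sum>i<n. \<Sum>j<n. \<Sum>k<n. \<Sum>l<n. (if j = k then A $$ (i, j) * B $$ (k, l) * h i l else 0) -
        (if i = l then A $$ (i, j) * B $$ (k, l) * h k j else 0))"
    unfolding coef_bracket by (intro sum.cong refl) (auto simp: h_def algebra_simps)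
  also have "\<dots> =
      (\<Sum>i<n. \<Sum>j<n. \<Sum>k<n. \<Sum>l<n. if j = k then A $$ (i, j) * B $$ (k, l) * h i l else 0) -
      (\<Sum>i<n. \<Sum>j<n. \<Sum>k<n. \<Sum>l<n. if i = l then A $$ (i, j) * B $$ (k, l) * h k j else 0)"
    by (simp only: sum_subtractf)
  also have "(\<Sum>i<n. \<Sum>j<n. \<Sum>k<n. \<Sum>l<n. if j = k then A $$ (i, j) * B $$ (k, l) * h i l else 0) =
      (\<Sum>i<n. \<Sum>l<n. (A * B) $$ (i, l) * h i l)"
  proof (rule sum.cong[OF refl])
    fix i assume i: "i \<in> {..<n}"
    have "(\<Sum>j<n. \<Sum>k<n. \<Sum>l<n. if j = k then A $$ (i, j) * B $$ (k, l) * h i l else 0) =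
        (\<Sum>j<n. \<Sum>l<n. A $$ (i, j) * B $$ (j, l) * h i l)"
      by (rule sum.cong[OF refl], rule trans[OF sum.swap], simp)
    also have "\<dots> = (\<Sum>l<n. \<Sum>j<n. A $$ (i, j) * B $$ (j, l) * h i l)"
      by (rule sum.swap)
    also have "\<dots> = (\<Sum>l<n. (A * B) $$ (i, l) * h i l)"
      using i by (intro sum.cong refl) (simp add: mat_mult_entry[OF A B] sum_distrib_right del: index_mult_mat)
    finally show "(\<Sum>j<n. \<Sum>k<n. \<Sum>l<n. if j = k then A $$ (i, j) * B $$ (k, l) * h i l else 0) = \<dots>" .
  qed
  also have "(\<Sum>i<n. \<Sum>j<n. \<Sum>k<n. \<Sum>l<n. if i = l then A $$ (i, j) * B $$ (k, l) * h k j else 0) =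
      (\<Sum>i<n. \<Sum>j<n. \<Sum>k<n. B $$ (k, i) * A $$ (i, j) * h k j)"
    by (intro sum.cong refl) (simp add: mult_ac)
  also have "\<dots> = (\<Sum>k<n. \<Sum>j<n. \<Sum>i<n. B $$ (k, i) * A $$ (i, j) * h k j)"
    by (rule trans[OF sum.cong[OF refl sum.swap]], rule trans[OF sum.swap],
        rule sum.cong[OF refl sum.swap])
  also have "\<dots> = (\<Sum>k<n. \<Sum>j<n. (B * A) $$ (k, j) * h k j)"
    by (intro sum.cong refl) (simp add: mat_mult_entry[OF B A] sum_distrib_right del: index_mult_mat)
  finally show "dop n s (A * B - B * A) F a =
      (dop n s A (dop n s B F) - dop n s B (dop n s A F)) a"
    using A B by (simp add: dop_def[of n s "A * B - B * A"] h_def left_diff_distrib sum_subtractf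
        del: index_mult_mat(1))
qed

lemma mat_unit_carrier [simp]: "mat_unit n i j \<in> carrier_mat n n"
  by (simp add: mat_unit_def)

lemma mat_unit_entry [simp]:
  "k < n \<Longrightarrow> l < n \<Longrightarrow> mat_unit n i j $$ (k, l) = (if k = i \<and> l = j then 1 else 0)"
  by (simp add: mat_unit_def)

lemma dop_mat_unit:
  assumes "i < n" "j < n"
  shows "dop n s (mat_unit n i j) F a = coef s i j (a - \<epsilon> i + \<epsilon> j) * F (a - \<epsilon> i + \<epsilon> j)"
proof -
  have "dop n s (mat_unit n i j) F a =
      (\<Sum>k<n. \<Sum>l<n. if l = j then (if k = i then coef s k l (a - \<epsilon> k + \<epsilon> l) * F (a - \<epsilon> k + \<epsilon> l) else 0) else 0)"
    unfolding dop_def by (intro sum.cong refl) auto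
  also have "\<dots> = coef s i j (a - \<epsilon> i + \<epsilon> j) * F (a - \<epsilon> i + \<epsilon> j)"
    using assms by (simp add: sum.delta)
  finally show ?thesis .
qed

lemma dop_nonzero:
  assumes "dop n s A F a \<noteq> 0"
  obtains i j where "i < n" "j < n" "coef s i j (a - \<epsilon> i + \<epsilon> j) \<noteq> 0" "F (a - \<epsilon> i + \<epsilon> j) \<noteq> 0"
proof -
  obtain i where i: "i < n"
    "(\<Sum>j<n. A $$ (i, j) * (coef s i j (a - \<epsilon> i + \<epsilon> j) * F (a - \<epsilon> i + \<epsilon> j))) \<noteq> 0"
    using sum.not_neutral_contains_not_neutral[OF assms[unfolded dop_def]] by blast
  obtain j where "j < n" "A $$ (i, j) * (coef s i j (a - \<epsilon> i + \<epsilon> j) * F (a - \<epsilon> i + \<epsilon> j)) \<noteq> 0"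
    using sum.not_neutral_contains_not_neutral[OF i(2)] by blast
  then have "j < n" "coef s i j (a - \<epsilon> i + \<epsilon> j) \<noteq> 0" "F (a - \<epsilon> i + \<epsilon> j) \<noteq> 0"
    by (metis mult_zero_left mult_zero_right)+
  with i(1) show ?thesis by (rule that)
qed

lemma coef_nonzero: "coef s i j c \<noteq> 0 \<Longrightarrow> j = 0 \<or> c j \<noteq> 0"
  by (auto simp: coef_def split: if_splits)

section \<open>The polynomial submodule\<close>

text \<open>
  The vanishing sum makes \<open>a 0\<close> equal to minus the degree of the monomial.
\<close>

definition PolExp :: "nat \<Rightarrow> exponent set" where
  "PolExp n = {a. (\<forall>j\<ge>n. a j = 0) \<and> (\<forall>j>0. 0 \<le> a j) \<and> (\<Sum>i<n. a i) = 0}"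

definition Pol :: "nat \<Rightarrow> laurent set" where
  "Pol n = {F. finite {a. F a \<noteq> 0} \<and> {a. F a \<noteq> 0} \<subseteq> PolExp n}"

lemma PolExp_0 [simp]: "0 \<in> PolExp n"
  by (simp add: PolExp_def)

lemma sum_unit_exp: "i < n \<Longrightarrow> (\<Sum>k<n. \<epsilon> i k) = 1"
  by (simp add: unit_exp_def)

lemma PolExp_shift:
  assumes "c \<in> PolExp n" "i < n" "j < n" "j = 0 \<or> 0 < c j \<or> i = j"
  shows "c + \<epsilon> i - \<epsilon> j \<in> PolExp n"
proof -
  have "(\<Sum>k<n. (c + \<epsilon> i - \<epsilon> j) k) = (\<Sum>k<n. c k) + (\<Sum>k<n. \<epsilon> i k) - (\<Sum>k<n. \<epsilon> j k)"
    by (simp add: sum.distrib sum_subtractf)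
  with assms show ?thesis
    unfolding PolExp_def mem_Collect_eq sum_unit_exp[OF assms(2)] sum_unit_exp[OF assms(3)]
    by (auto simp: unit_exp_def)
qed

lemma PolExp_nonzero:
  assumes "a \<in> PolExp n" "a \<noteq> 0"
  obtains k where "0 < k" "k < n" "0 < a k" "a 0 < 0"
proof -
  have n: "0 < n" using assms by (auto simp: PolExp_def fun_eq_iff)
  have "\<exists>k. 0 < k \<and> k < n \<and> 0 < a k"
  proof (rule ccontr)
    assume "\<not> ?thesis"
    then have neg: "\<not> 0 < a k" if "0 < k" "k < n" for k
      using that by blast
    have *: "a k = 0" if "k > 0" for k
    proof (cases "k < n")
      case True
      moreover have "0 \<le> a k" using assms(1) that by (simp add: PolExp_def)
      ultimately show ?thesis using neg[of k] that by simp
    qed (use assms(1) in \<open>simp add: PolExp_def\<close>)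
    have "(\<Sum>i<n. a i) = (\<Sum>i<n. if i = 0 then a 0 else 0)"
      by (intro sum.cong) (auto simp: *)
    then have "a 0 = 0" using n assms(1) by (simp add: PolExp_def)
    with * have "a k = 0" for k by (cases "k = 0") auto
    then show False using assms(2) by (simp add: fun_eq_iff)
  qed
  then obtain k where k: "0 < k" "k < n" "0 < a k" by blast
  have "0 = a 0 + (\<Sum>i\<in>{..<n} - {0}. a i)"
    using n assms(1) sum.remove[of "{..<n}" 0 a] by (simp add: PolExp_def)
  moreover have "(\<Sum>i\<in>{..<n} - {0}. a i) \<ge> a k"
    using k assms(1) by (intro member_le_sum) (auto simp: PolExp_def)
  ultimately have "a 0 < 0" using k by linarith
  with k show ?thesis by (rule that)
qed

lemma Pol_add: "F \<in> Pol n \<Longrightarrow> G \<in> Pol n \<Longrightarrow> F + G \<in> Pol n"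
proof -
  assume *: "F \<in> Pol n" "G \<in> Pol n"
  have "{a. (F + G) a \<noteq> 0} \<subseteq> {a. F a \<noteq> 0} \<union> {a. G a \<noteq> 0}" by auto
  then show "F + G \<in> Pol n"
    using * unfolding Pol_def by (auto intro: finite_subset)
qed

lemma Pol_mult: "F \<in> Pol n \<Longrightarrow> (\<lambda>a. c * F a) \<in> Pol n"
  unfolding Pol_def by (auto elim: finite_subset[rotated])

lemma Pol_delta: "b \<in> PolExp n \<Longrightarrow> delta b \<in> Pol n"
  by (auto simp: Pol_def delta_def)

lemma Pol_induct [consumes 1, case_names zero single add]:
  assumes F: "F \<in> Pol n" and zero: "P 0"
    and single: "\<And>c b. b \<in> PolExp n \<Longrightarrow> P (\<lambda>a. c * delta b a)"
    and add: "\<And>F G. F \<in> Pol n \<Longrightarrow> G \<in> Pol n \<Longrightarrow> P F \<Longrightarrow> P G \<Longrightarrow> P (F + G)"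
  shows "P F"
proof -
  have "P F" if "finite B" "B \<subseteq> PolExp n" "{a. F a \<noteq> 0} \<subseteq> B" for B F
    using that
  proof (induction B arbitrary: F)
    case empty
    then have "F = 0" by (auto simp: fun_eq_iff)
    with zero show ?case by (simp only:)
  next
    case (insert b B)
    let ?G = "\<lambda>a. if a = b then 0 else F a"
    have B: "{a. ?G a \<noteq> 0} \<subseteq> B" using insert by auto
    have "P ?G" using insert B by (intro insert.IH) auto
    moreover have "?G \<in> Pol n"
      using insert B unfolding Pol_def by (auto intro: finite_subset)
    moreover have "F = (\<lambda>a. F b * delta b a) + ?G"
      by (rule ext) (simp add: delta_def)
    moreover have "(\<lambda>a. F b * delta b a) \<in> Pol n" "P (\<lambda>a. F b * delta b a)"
      using insert by (auto intro: Pol_mult Pol_delta single)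
    ultimately show ?case using add by metis
  qed
  then show ?thesis using F by (auto simp: Pol_def)
qed

text \<open>
  A shift by \<open>\<epsilon> i - \<epsilon> j\<close> can only leave the polynomial exponents when \<open>j > 0\<close>, \<open>i \<noteq> j\<close> and the entry with index
  \<open>j\<close> is zero, and then this entry occurs as a factor of the coefficient.
\<close>

lemma Pol_dop:
  assumes "F \<in> Pol n"
  shows "dop n s A F \<in> Pol n"
proof -
  have *: "\<exists>i<n. \<exists>j<n. \<exists>c. F c \<noteq> 0 \<and> a = c + \<epsilon> i - \<epsilon> j \<and> a \<in> PolExp n" if "dop n s A F a \<noteq> 0" for a
  proof -
    obtain i j where ij: "i < n" "j < n" "coef s i j (a - \<epsilon> i + \<epsilon> j) \<noteq> 0" "F (a - \<epsilon> i + \<epsilon> j) \<noteq> 0"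
      using dop_nonzero[OF \<open>dop n s A F a \<noteq> 0\<close>] .
    let ?c = "a - \<epsilon> i + \<epsilon> j"
    have c: "?c \<in> PolExp n" using assms ij by (auto simp: Pol_def)
    have "j = 0 \<or> ?c j \<noteq> 0"
      by (rule coef_nonzero[OF ij(3)])
    then have "j = 0 \<or> 0 < ?c j" using c by (force simp: PolExp_def)
    then have "?c + \<epsilon> i - \<epsilon> j \<in> PolExp n"
      using c ij by (intro PolExp_shift) auto
    moreover have "?c + \<epsilon> i - \<epsilon> j = a" by simp
    ultimately show ?thesis using ij by metis
  qed
  have "{a. dop n s A F a \<noteq> 0} \<subseteq> (\<Union>i<n. \<Union>j<n. (\<lambda>c. c + \<epsilon> i - \<epsilon> j) ` {c. F c \<noteq> 0})"
  proof (rule subsetI)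
    fix a assume "a \<in> {a. dop n s A F a \<noteq> 0}"
    then obtain i j c where "i < n" "j < n" "F c \<noteq> 0" "a = c + \<epsilon> i - \<epsilon> j"
      using *[of a] by blast
    then show "a \<in> (\<Union>i<n. \<Union>j<n. (\<lambda>c. c + \<epsilon> i - \<epsilon> j) ` {c. F c \<noteq> 0})"
      by (intro UN_I[of i] UN_I[of j] image_eqI[of _ _ c]) simp_all
  qed
  moreover have "finite \<dots>" using assms by (auto simp: Pol_def)
  ultimately show ?thesis
    using * unfolding Pol_def by (auto intro: finite_subset)
qed

section \<open>The special linear algebra and its parabolic subalgebra\<close>

lemma sl_carrier: "A \<in> sl n \<Longrightarrow> A \<in> carrier_mat n n"
  by (simp add: sl_def)

lemma trace_mult_commute:
  fixes A B :: "complex mat"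
  assumes "A \<in> carrier_mat n n" "B \<in> carrier_mat n n"
  shows "(\<Sum>i<n. (A * B) $$ (i, i)) = (\<Sum>i<n. (B * A) $$ (i, i))"
proof -
  have "(\<Sum>i<n. (A * B) $$ (i, i)) = (\<Sum>i<n. \<Sum>k<n. A $$ (i, k) * B $$ (k, i))"
    by (intro sum.cong refl) (simp add: mat_mult_entry[OF assms] del: index_mult_mat)
  also have "\<dots> = (\<Sum>k<n. \<Sum>i<n. A $$ (i, k) * B $$ (k, i))"
    by (rule sum.swap)
  also have "\<dots> = (\<Sum>i<n. (B * A) $$ (i, i))"
    by (intro sum.cong refl)
      (simp add: mat_mult_entry[OF assms(2,1)] mult.commute del: index_mult_mat)
  finally show ?thesis .
qed

lemma matrix_lie_algebra_sl: "matrix_lie_algebra (sl n)"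
proof
  fix x y c assume x: "x \<in> sl n"
  then show "c \<cdot>\<^sub>m x \<in> sl n"
    by (auto simp: sl_def sum_distrib_left[symmetric])
  assume y: "y \<in> sl n"
  with x show "x + y \<in> sl n"
    by (auto simp: sl_def sum.distrib)
  have "(\<Sum>i<n. (x * y - y * x) $$ (i, i)) = (\<Sum>i<n. (x * y) $$ (i, i)) - (\<Sum>i<n. (y * x) $$ (i, i))"
    using x y by (subst sum_subtractf[symmetric], intro sum.cong refl)
      (auto simp: sl_def simp del: index_mult_mat(1))
  with x y show "x * y - y * x \<in> sl n"
    by (auto simp: sl_def trace_mult_commute[of y n x] intro!: minus_carrier_mat mult_carrier_mat)
qed

lemma mat_unit_sl: "i \<noteq> j \<Longrightarrow> mat_unit n i j \<in> sl n"
  by (auto simp: sl_def intro!: sum.neutral)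

lemma H0_entry:
  "i < n \<Longrightarrow> j < n \<Longrightarrow>
    H0 n $$ (i, j) = (if i = j then if i = 0 then of_nat (n - 1) / of_nat (n - 1) else - 1 / of_nat (n - 1) else 0)"
  by (simp add: H0_def mat_diag_def)

lemma H0_carrier: "H0 n \<in> carrier_mat n n"
  by (simp add: H0_def mat_diag_def)

lemma nil_plus_entry:
  assumes "i < n" "j < n"
  shows "mat n n (\<lambda>ij. \<Sum>k = 1..n - 1. c k * mat_unit n 0 k $$ ij) $$ (i, j) =
    (if i = 0 \<and> j \<noteq> 0 then c j else 0)"
proof -
  have "(\<Sum>k = 1..n - 1. c k * mat_unit n 0 k $$ (i, j)) =
      (\<Sum>k = 1..n - 1. if k = j then (if i = 0 then c k else 0) else 0)"
    using assms by (intro sum.cong) auto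
  also have "\<dots> = (if i = 0 \<and> j \<noteq> 0 then c j else 0)"
    using assms by (auto simp: sum.delta)
  finally show ?thesis using assms by simp
qed

lemma levi_m_entry:
  assumes "X \<in> carrier_mat (n - 1) (n - 1)" "i < n" "j < n"
  shows "four_block_mat (0\<^sub>m 1 1) (0\<^sub>m 1 (n - 1)) (0\<^sub>m (n - 1) 1) X $$ (i, j) =
    (if i = 0 \<or> j = 0 then 0 else X $$ (i - 1, j - 1))"
  using assms by (subst index_mat_four_block) auto

lemma levi_m_carrier:
  assumes "2 \<le> n" "X \<in> carrier_mat (n - 1) (n - 1)"
  shows "four_block_mat (0\<^sub>m 1 1) (0\<^sub>m 1 (n - 1)) (0\<^sub>m (n - 1) 1) X \<in> carrier_mat n n"
  using four_block_carrier_mat[OF zero_carrier_mat[of 1 1] assms(2)] assms(1) by simp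

lemma sum_split_first: "2 \<le> n \<Longrightarrow> (\<Sum>i<n. f i) = f 0 + (\<Sum>i<n - 1. f (Suc i))" for f :: "nat \<Rightarrow> complex"
  by (cases n) (simp_all add: sum.lessThan_Suc_shift del: sum.lessThan_Suc)

lemma parabolic_decompD:
  assumes n: "2 \<le> n" and Y: "Y \<in> levi_m n" and Z: "Z \<in> nil_plus n"
    and A: "A = Y + c \<cdot>\<^sub>m H0 n + Z"
  shows "A \<in> sl n" "\<And>i. 0 < i \<Longrightarrow> i < n \<Longrightarrow> A $$ (i, 0) = 0" "A $$ (0, 0) = c"
proof -
  obtain X where X: "X \<in> sl (n - 1)"
    "Y = four_block_mat (0\<^sub>m 1 1) (0\<^sub>m 1 (n - 1)) (0\<^sub>m (n - 1) 1) X"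
    using Y by (auto simp: levi_m_def)
  obtain d where d: "Z = mat n n (\<lambda>ij. \<Sum>k = 1..n - 1. d k * mat_unit n 0 k $$ ij)"
    using Z by (auto simp: nil_plus_def)
  have Yc: "Y \<in> carrier_mat n n"
    unfolding X(2) by (rule levi_m_carrier[OF n sl_carrier[OF X(1)]])
  have Zc: "Z \<in> carrier_mat n n" by (simp add: d)
  have Ac: "A \<in> carrier_mat n n" using Yc Zc H0_carrier[of n] by (simp add: A)
  have entry: "A $$ (i, j) = (if i = 0 \<or> j = 0 then 0 else X $$ (i - 1, j - 1)) +
      c * (if i = j then if i = 0 then of_nat (n - 1) / of_nat (n - 1) else - 1 / of_nat (n - 1) else 0) +
      (if i = 0 \<and> j \<noteq> 0 then d j else 0)" if ij: "i < n" "j < n" for i j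
  proof -
    have "A $$ (i, j) = Y $$ (i, j) + c * H0 n $$ (i, j) + Z $$ (i, j)"
      using ij Yc Zc H0_carrier[of n] by (simp add: A)
    then show ?thesis
      unfolding X(2) d levi_m_entry[OF sl_carrier[OF X(1)] ij] H0_entry[OF ij] nil_plus_entry[OF ij] .
  qed
  show "A $$ (i, 0) = 0" if "0 < i" "i < n" for i
    using that by (simp add: entry)
  show A00: "A $$ (0, 0) = c"
    using n by (simp add: entry)
  have "A $$ (Suc i, Suc i) = X $$ (i, i) - c / of_nat (n - 1)" if "i < n - 1" for i
    using that by (simp add: entry)
  then have "(\<Sum>i<n. A $$ (i, i)) = c + (\<Sum>i<n - 1. X $$ (i, i) - c / of_nat (n - 1))"
    using n by (simp add: sum_split_first A00)
  also have "\<dots> = 0"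
    using X(1) n by (simp add: sum_subtractf sl_def)
  finally show "A \<in> sl n" using Ac by (simp add: sl_def)
qed

lemma parabolic_decomp_exists:
  assumes n: "2 \<le> n" and A: "A \<in> sl n" and col: "\<And>i. 0 < i \<Longrightarrow> i < n \<Longrightarrow> A $$ (i, 0) = 0"
  obtains Y Z where "Y \<in> levi_m n" "Z \<in> nil_plus n" "A = Y + A $$ (0, 0) \<cdot>\<^sub>m H0 n + Z"
proof
  define X where "X = mat (n - 1) (n - 1)
    (\<lambda>(i, j). A $$ (Suc i, Suc j) + (if i = j then A $$ (0, 0) / of_nat (n - 1) else 0))"
  let ?Y = "four_block_mat (0\<^sub>m 1 1) (0\<^sub>m 1 (n - 1)) (0\<^sub>m (n - 1) 1) X"
  let ?Z = "mat n n (\<lambda>ij. \<Sum>k = 1..n - 1. A $$ (0, k) * mat_unit n 0 k $$ ij)"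
  have Xc: "X \<in> carrier_mat (n - 1) (n - 1)" by (simp add: X_def)
  have "(\<Sum>i<n - 1. X $$ (i, i)) = (\<Sum>i<n - 1. A $$ (Suc i, Suc i)) + A $$ (0, 0)"
    using n by (simp add: X_def sum.distrib)
  also have "\<dots> = 0"
    using A sum_split_first[OF n, of "\<lambda>i. A $$ (i, i)"] by (simp add: sl_def add.commute)
  finally have "X \<in> sl (n - 1)" using Xc by (simp add: sl_def)
  then show "?Y \<in> levi_m n" by (auto simp: levi_m_def)
  show "?Z \<in> nil_plus n" by (auto simp: nil_plus_def)
  have Yc: "?Y \<in> carrier_mat n n" by (rule levi_m_carrier[OF n Xc])
  have Ac: "A \<in> carrier_mat n n" using A by (rule sl_carrier)
  show "A = ?Y + A $$ (0, 0) \<cdot>\<^sub>m H0 n + ?Z"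
  proof (rule eq_matI)
    fix i j assume "i < dim_row (?Y + A $$ (0, 0) \<cdot>\<^sub>m H0 n + ?Z)" "j < dim_col (?Y + A $$ (0, 0) \<cdot>\<^sub>m H0 n + ?Z)"
    then have ij: "i < n" "j < n" by simp_all
    have "(?Y + A $$ (0, 0) \<cdot>\<^sub>m H0 n + ?Z) $$ (i, j) =
        ?Y $$ (i, j) + A $$ (0, 0) * H0 n $$ (i, j) + ?Z $$ (i, j)"
      using ij Yc H0_carrier[of n] by (simp del: index_mat_four_block(1))
    also have "\<dots> = A $$ (i, j)"
    proof -
      have "X $$ (i - 1, j - 1) = A $$ (i, j) + (if i = j then A $$ (0, 0) / of_nat (n - 1) else 0)"
        if "i \<noteq> 0" "j \<noteq> 0"
        using that ij by (simp add: X_def)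
      then show ?thesis
        unfolding levi_m_entry[OF Xc ij] H0_entry[OF ij] nil_plus_entry[OF ij]
        using n ij col[of i] by auto
    qed
    finally show "A $$ (i, j) = (?Y + A $$ (0, 0) \<cdot>\<^sub>m H0 n + ?Z) $$ (i, j)" by simp
  qed (use Ac in simp_all)
qed

text \<open>
  The three summands of the parabolic subalgebra only restrict the first column below the diagonal;
  the coefficient of \<^const>\<open>H0\<close> is the entry with index \<open>(0, 0)\<close>, as this entry of \<open>H0 n\<close> is \<open>1\<close>.
\<close>

lemma parabolic_iff:
  assumes "2 \<le> n"
  shows "A \<in> parabolic n \<longleftrightarrow> A \<in> sl n \<and> (\<forall>i. 0 < i \<and> i < n \<longrightarrow> A $$ (i, 0) = 0)"
proof
  assume "A \<in> parabolic n"
  then obtain Y c Z where "Y \<in> levi_m n" "Z \<in> nil_plus n" "A = Y + c \<cdot>\<^sub>m H0 n + Z"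
    by (auto simp: parabolic_def)
  from parabolic_decompD[OF assms this]
  show "A \<in> sl n \<and> (\<forall>i. 0 < i \<and> i < n \<longrightarrow> A $$ (i, 0) = 0)" by blast
next
  assume "A \<in> sl n \<and> (\<forall>i. 0 < i \<and> i < n \<longrightarrow> A $$ (i, 0) = 0)"
  then obtain Y Z where "Y \<in> levi_m n" "Z \<in> nil_plus n" "A = Y + A $$ (0, 0) \<cdot>\<^sub>m H0 n + Z"
    using parabolic_decomp_exists[OF assms] by blast
  then show "A \<in> parabolic n" unfolding parabolic_def by blast
qed

lemma triv_rep_eq:
  assumes n: "2 \<le> n" and A: "A \<in> parabolic n"
  shows "triv_rep n s A v = s * A $$ (0, 0) * v"
  unfolding triv_rep_def
proof (rule the_equality)
  obtain Y Z where "Y \<in> levi_m n" "Z \<in> nil_plus n" "A = Y + A $$ (0, 0) \<cdot>\<^sub>m H0 n + Z"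
    using A parabolic_decomp_exists[OF n] unfolding parabolic_iff[OF n] by blast
  then show "\<exists>Y c Z. Y \<in> levi_m n \<and> Z \<in> nil_plus n \<and> A = Y + c \<cdot>\<^sub>m H0 n + Z \<and>
      s * A $$ (0, 0) * v = c * (s * v)"
    by (intro exI[of _ Y] exI[of _ "A $$ (0, 0)"] exI[of _ Z]) simp
next
  fix w assume "\<exists>Y c Z. Y \<in> levi_m n \<and> Z \<in> nil_plus n \<and> A = Y + c \<cdot>\<^sub>m H0 n + Z \<and> w = c * (s * v)"
  then show "w = s * A $$ (0, 0) * v"
    using parabolic_decompD(3)[OF n] by auto
qed

lemma mult_entry_col_0:
  fixes A B :: "complex mat"
  assumes "A \<in> carrier_mat n n" "B \<in> carrier_mat n n" "\<And>k. 0 < k \<Longrightarrow> k < n \<Longrightarrow> B $$ (k, 0) = 0" "i < n"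
  shows "(A * B) $$ (i, 0) = A $$ (i, 0) * B $$ (0, 0)"
proof -
  have n: "0 < n" using assms(4) by simp
  have "(A * B) $$ (i, 0) = (\<Sum>k<n. A $$ (i, k) * B $$ (k, 0))"
    by (rule mat_mult_entry[OF assms(1,2,4) n])
  also have "\<dots> = (\<Sum>k<n. if k = 0 then A $$ (i, 0) * B $$ (0, 0) else 0)"
    by (intro sum.cong) (auto simp: assms(3))
  finally show ?thesis using n by simp
qed

text \<open>
  In the product of two block upper triangular matrices, the first columns multiply like numbers in
  the position \<open>(0, 0)\<close>; for the commutator they cancel, so the character is zero on brackets.
\<close>

lemma parabolic_bracket_col_0:
  assumes n: "2 \<le> n" and x: "x \<in> parabolic n" and y: "y \<in> parabolic n" and i: "i < n"
  shows "(x * y - y * x) $$ (i, 0) = 0"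
proof -
  have c: "x \<in> carrier_mat n n" "y \<in> carrier_mat n n"
    using x y by (auto simp: parabolic_iff[OF n] sl_carrier)
  have "(x * y) $$ (i, 0) = x $$ (i, 0) * y $$ (0, 0)" "(y * x) $$ (i, 0) = y $$ (i, 0) * x $$ (0, 0)"
    using x y i c unfolding parabolic_iff[OF n] by (intro mult_entry_col_0; blast)+
  moreover have "(x * y - y * x) $$ (i, 0) = (x * y) $$ (i, 0) - (y * x) $$ (i, 0)"
    using c i by (subst index_minus_mat) auto
  ultimately show ?thesis
    using x y i by (cases "i = 0") (auto simp: parabolic_iff[OF n])
qed

lemma matrix_lie_algebra_parabolic:
  assumes n: "2 \<le> n"
  shows "matrix_lie_algebra (parabolic n)"
proof -
  interpret sl: matrix_lie_algebra "sl n" by (rule matrix_lie_algebra_sl)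
  show ?thesis
  proof
    fix x y c assume x: "x \<in> parabolic n"
    then show "c \<cdot>\<^sub>m x \<in> parabolic n"
      using sl_carrier[of x n] by (auto simp: parabolic_iff[OF n] intro: sl.smult_closed)
    assume y: "y \<in> parabolic n"
    with x show "x + y \<in> parabolic n"
      using sl_carrier[of x n] sl_carrier[of y n] n
      by (auto simp: parabolic_iff[OF n] intro: sl.add_closed)
    show "x * y - y * x \<in> parabolic n"
      using x y sl.bracket_closed[of x y] parabolic_bracket_col_0[OF n x y]
      by (simp add: parabolic_iff[OF n])
  qed
qed

lemma induced_character_parabolic:
  assumes n: "2 \<le> n"
  shows "induced_character (sl n) (parabolic n) (triv_rep n s) (\<lambda>x. s * x $$ (0, 0))"
proof -
  interpret sl: matrix_lie_algebra "sl n" by (rule matrix_lie_algebra_sl)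
  interpret p: matrix_lie_algebra "parabolic n" by (rule matrix_lie_algebra_parabolic[OF n])
  have c: "x \<in> carrier_mat n n" if "x \<in> parabolic n" for x
    using that by (auto simp: parabolic_iff[OF n] sl_carrier)
  show ?thesis
  proof
    show "parabolic n \<subseteq> sl n" by (auto simp: parabolic_iff[OF n])
    fix x y k v assume x: "x \<in> parabolic n"
    then show "triv_rep n s x v = s * x $$ (0, 0) * v" by (rule triv_rep_eq[OF n])
    show "s * (k \<cdot>\<^sub>m x) $$ (0, 0) = k * (s * x $$ (0, 0))"
      using n c[OF x] by simp
    assume y: "y \<in> parabolic n"
    show "s * (x + y) $$ (0, 0) = s * x $$ (0, 0) + s * y $$ (0, 0)"
      using n c[OF x] c[OF y] by (simp add: distrib_left)
    show "s * (x * y - y * x) $$ (0, 0) = 0"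
      using n parabolic_bracket_col_0[OF n x y, of 0] by simp
  qed
qed

section \<open>The polynomial model as a module over the enveloping algebra\<close>

lemma act_dop_ideal:
  assumes "f \<in> uea_ideal (sl n)"
  shows "act (dop n s) f F = 0"
proof -
  interpret sl: matrix_lie_algebra "sl n" by (rule matrix_lie_algebra_sl)
  note lin = linear_op_dop[of n s]
  let ?J = "{f \<in> free_alg_on (sl n). \<forall>F. act (dop n s) f F = 0}"
  have zero: "act (dop n s) f 0 = 0" for f
    using linear_op_act[of "dop n s" f, OF lin] unfolding linear_op_def
    by (metis add_cancel_left_left)
  have "uea_ideal (sl n) \<subseteq> ?J"
  proof (rule sl.uea_ideal_minimal)
    have "act (dop n s) (- f) F = - act (dop n s) f F" for f F
      using act_diff[of "dop n s" 0 f F] by simp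
    then show "ideal ?J (free_algebra (sl n))"
      by (intro ideal_free_algebraI)
        (auto intro: free_alg_on_intros free_alg_on_uminus simp: act_add act_mult[OF lin] zero)
    show "uea_rels (sl n) \<subseteq> ?J"
    proof
      fix f assume f: "f \<in> uea_rels (sl n)"
      then have "act (dop n s) f F = 0" for F
        unfolding uea_rels_def
        by (auto simp: act_diff act_mult[OF lin] act_gen act_scal dop_add_mat dop_smult_mat
            dop_bracket sl_carrier)
      with f sl.uea_rels_subset show "f \<in> ?J" by blast
    qed
  qed
  with assms show ?thesis by blast
qed

text \<open>
  The constant monomial satisfies the relations of \<open>1 \<otimes> 1\<close>: all coefficients at the exponent \<open>0\<close>
  vanish, except those of the lowering operators and of \<open>E\<^sub>0\<^sub>,\<^sub>0\<close>.
\<close>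

lemma dop_parabolic_delta_0:
  assumes n: "2 \<le> n" and x: "x \<in> parabolic n"
  shows "dop n s x (delta 0) = (\<lambda>a. s * x $$ (0, 0) * delta 0 a)"
proof
  fix a
  have "x $$ (i, j) * (coef s i j (a - \<epsilon> i + \<epsilon> j) * delta 0 (a - \<epsilon> i + \<epsilon> j)) =
      (if j = 0 then if i = 0 then s * x $$ (0, 0) * delta 0 a else 0 else 0)" if "i < n" for i j
  proof (cases "a - \<epsilon> i + \<epsilon> j = 0")
    case True
    show ?thesis
    proof (cases "j = 0")
      case j: True
      show ?thesis
      proof (cases "i = 0")
        case False
        then show ?thesis using x that j by (simp add: parabolic_iff[OF n])
      qed (use True j in \<open>simp add: coef_def mult.commute\<close>)
    next
      case False
      then show ?thesis unfolding True by (simp add: coef_def)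
    qed
  next
    case False
    then show ?thesis by (auto simp: delta_def)
  qed
  then have "dop n s x (delta 0) a = (\<Sum>i<n. \<Sum>j<n. if j = 0 then if i = 0 then s * x $$ (0, 0) * delta 0 a else 0 else 0)"
    unfolding dop_def by (intro sum.cong refl) auto
  also have "\<dots> = s * x $$ (0, 0) * delta 0 a"
    using n by (simp add: sum.delta)
  finally show "dop n s x (delta 0) a = s * x $$ (0, 0) * delta 0 a" .
qed

lemma dop_lower_delta:
  assumes "0 < k" "k < n"
  shows "dop n s (mat_unit n k 0) (delta b) = delta (b + \<epsilon> k - \<epsilon> 0)"
proof
  fix a
  have "a - \<epsilon> k + \<epsilon> 0 = b \<longleftrightarrow> a = b + \<epsilon> k - \<epsilon> 0"
    by (auto simp: algebra_simps)
  then show "dop n s (mat_unit n k 0) (delta b) a = delta (b + \<epsilon> k - \<epsilon> 0) a"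
    using assms by (simp add: dop_mat_unit coef_def delta_def)
qed

text \<open>
  The homomorphism from the generalized Verma module to the model that maps \<open>[f] \<otimes> 1\<close> to the action of
  \<open>f\<close> on the constant monomial is well-defined.
\<close>

lemma ind_vec_eq_one_imp_act:
  assumes n: "2 \<le> n" and f: "f \<in> free_alg_on (sl n)"
    and 1: "induced_character.ind_vec (sl n) (parabolic n) (triv_rep n s) f = \<one>\<^bsub>gen_verma n s\<^esub>"
  shows "act (dop n s) f (delta 0) = 0"
proof
  fix a
  interpret induced_character "sl n" "parabolic n" "triv_rep n s" "\<lambda>x. s * x $$ (0, 0)"
    by (rule induced_character_parabolic[OF n])
  note lin = linear_op_dop[of n s]
  have char: "act (dop n s) r (delta 0) = (\<lambda>a. \<chi>\<^sub>f r * delta 0 a)" if "r \<in> free_alg_on (parabolic n)" for r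
    using that
  proof (induction rule: free_alg_on_word_induct)
    case one
    show ?case using act_scal[of "dop n s" 1 "delta 0"] \<chi>\<^sub>f_simps(5)[of 1] by simp
  next
    case (add f g)
    then show ?case by (simp add: act_add distrib_right fun_eq_iff)
  next
    case (scal c f)
    then show ?case by (simp add: act_mult[OF lin] act_scal mult.assoc)
  next
    case (gen x f)
    then show ?case
      by (simp only: act_mult[OF lin] act_gen dop_mult dop_parabolic_delta_0[OF n] \<chi>\<^sub>f_simps)
        (simp add: mult_ac zero_fun_def)
  qed
  have "act (dop n s) f (delta 0) a = 0"
  proof (rule ind_vec_eq_one_imp[where e = "\<lambda>f. act (dop n s) f (delta 0) a", OF _ _ _ f])
    show "ind_vec f = \<one>\<^bsub>M\<^esub>" using 1 by (simp add: gen_verma_def)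
    fix f r assume "r \<in> free_alg_on (parabolic n)"
    then have "act (dop n s) (f * r) (delta 0) = act (dop n s) f (\<lambda>a. \<chi>\<^sub>f r * delta 0 a)"
      by (simp add: act_mult[OF lin] char)
    also have "\<dots> = (\<lambda>a. \<chi>\<^sub>f r * act (dop n s) f (delta 0) a)"
      using linear_op_act[of "dop n s" f, OF lin] unfolding linear_op_def by blast
    finally show "act (dop n s) (f * r) (delta 0) a = \<chi>\<^sub>f r * act (dop n s) f (delta 0) a" by simp
  qed (simp_all add: act_add act_dop_ideal)
  then show "act (dop n s) f (delta 0) a = 0 a" by simp
qed

section \<open>Ordered monomials in the lowering operators\<close>

definition low :: "nat \<Rightarrow> nat \<Rightarrow> complex mat free_alg" where
  "low n k = gen (mat_unit n k 0)"

text \<open>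
  The factors with indices \<open>1, \<dots>, m\<close> in increasing order; the complete monomial has \<open>m = n - 1\<close>. A fixed
  order is necessary because the factors commute only modulo the defining ideal of the enveloping
  algebra.
\<close>

fun low_monom :: "nat \<Rightarrow> exponent \<Rightarrow> nat \<Rightarrow> complex mat free_alg" where
  "low_monom n a 0 = 1"
| "low_monom n a (Suc m) = low_monom n a m * low n (Suc m) ^ nat (a (Suc m))"

text \<open>
  The map from polynomial functions to the free algebra which, after passing to the module, inverts the
  action on the constant monomial.
\<close>

definition low_poly :: "nat \<Rightarrow> laurent \<Rightarrow> complex mat free_alg" where
  "low_poly n F = (\<Sum>a | F a \<noteq> 0. scal (F a) * low_monom n a (n - 1))"

lemma free_alg_on_power: "f \<in> free_alg_on S \<Longrightarrow> f ^ k \<in> free_alg_on S"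
  by (induction k) (auto intro: free_alg_on_intros)

lemma low_closed: "0 < k \<Longrightarrow> low n k \<in> free_alg_on (sl n)"
  by (simp add: low_def free_alg_on_gen mat_unit_sl)

lemma low_monom_closed: "low_monom n a m \<in> free_alg_on (sl n)"
  by (induction m) (auto intro: free_alg_on_intros free_alg_on_power low_closed)

lemma free_alg_on_sum: "(\<And>x. x \<in> A \<Longrightarrow> f x \<in> free_alg_on S) \<Longrightarrow> sum f A \<in> free_alg_on S"
  by (induction A rule: infinite_finite_induct) (auto intro: free_alg_on_intros)

lemma low_poly_closed: "low_poly n F \<in> free_alg_on (sl n)"
  unfolding low_poly_def
  by (intro free_alg_on_sum free_alg_on_mult low_monom_closed) simp

lemma low_poly_superset:
  assumes "finite B" "{a. F a \<noteq> 0} \<subseteq> B"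
  shows "low_poly n F = (\<Sum>a\<in>B. scal (F a) * low_monom n a (n - 1))"
  unfolding low_poly_def by (rule sum.mono_neutral_left) (use assms in auto)

lemma low_poly_0 [simp]: "low_poly n 0 = 0"
  by (simp add: low_poly_def)

lemma low_poly_add:
  assumes "F \<in> Pol n" "G \<in> Pol n"
  shows "low_poly n (F + G) = low_poly n F + low_poly n G"
proof -
  let ?B = "{a. F a \<noteq> 0} \<union> {a. G a \<noteq> 0}"
  have B: "finite ?B" using assms by (simp add: Pol_def)
  have "{a. (F + G) a \<noteq> 0} \<subseteq> ?B" by auto
  then have "low_poly n (F + G) = (\<Sum>a\<in>?B. scal ((F + G) a) * low_monom n a (n - 1))"
    by (rule low_poly_superset[OF B])
  also have "\<dots> = (\<Sum>a\<in>?B. scal (F a) * low_monom n a (n - 1)) + (\<Sum>a\<in>?B. scal (G a) * low_monom n a (n - 1))"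
    by (simp add: scal_add distrib_right sum.distrib)
  also have "\<dots> = low_poly n F + low_poly n G"
    by (simp add: low_poly_superset[OF B])
  finally show ?thesis .
qed

lemma low_poly_mult: "low_poly n (\<lambda>a. c * F a) = scal c * low_poly n F"
proof (cases "c = 0")
  case True
  then show ?thesis by (simp add: low_poly_def)
next
  case False
  then show ?thesis by (simp add: low_poly_def scal_mult sum_distrib_left mult.assoc)
qed

lemma low_poly_delta: "low_poly n (delta b) = low_monom n b (n - 1)"
  by (simp add: low_poly_def delta_def)

lemma low_commute:
  assumes "0 < k" "k < n" "0 < j" "j < n"
  shows "low n k * low n j - low n j * low n k \<in> uea_ideal (sl n)"
proof -
  interpret sl: matrix_lie_algebra "sl n" by (rule matrix_lie_algebra_sl)
  let ?x = "mat_unit n k 0" and ?y = "mat_unit n j 0"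
  have sl: "?x \<in> sl n" "?y \<in> sl n" using assms by (simp_all add: mat_unit_sl)
  have prod: "mat_unit n i 0 * mat_unit n l 0 = 0\<^sub>m n n" if "0 < l" for i l
    using that
    by (intro eq_matI) (auto simp: mat_mult_entry[of _ n] carrier_matD[OF mat_unit_carrier]
        simp del: index_mult_mat(1) intro!: sum.neutral)
  have "?x * ?y - ?y * ?x = 0 \<cdot>\<^sub>m ?x"
    using assms by (simp add: prod) (intro eq_matI, auto simp: carrier_matD[OF mat_unit_carrier])
  then have "gen ?x * gen ?y - gen ?y * gen ?x - gen (0 \<cdot>\<^sub>m ?x) \<in> uea_ideal (sl n)"
    using sl.gen_bracket_rel[OF sl] by simp
  moreover have "gen (0 \<cdot>\<^sub>m ?x) \<in> uea_ideal (sl n)"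
    using sl.gen_smult_rel[OF sl(1), of 0] by simp
  ultimately show ?thesis
    unfolding low_def using sl.uea_ideal_add by fastforce
qed

lemma commutator_mult_ideal:
  assumes "x \<in> free_alg_on (sl n)" "f \<in> free_alg_on (sl n)" "h \<in> free_alg_on (sl n)"
    and "x * f - f * x \<in> uea_ideal (sl n)" "x * h - h * x \<in> uea_ideal (sl n)"
  shows "x * (f * h) - (f * h) * x \<in> uea_ideal (sl n)"
proof -
  interpret sl: matrix_lie_algebra "sl n" by (rule matrix_lie_algebra_sl)
  have "(x * f - f * x) * h + f * (x * h - h * x) \<in> uea_ideal (sl n)"
    using assms by (intro sl.uea_ideal_add sl.uea_ideal_mult_left sl.uea_ideal_mult_right)
  then show ?thesis by (simp add: algebra_simps)
qed

lemma low_commute_monom: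
  assumes k: "0 < k" "k < n" and m: "m < n"
  shows "low n k * low_monom n a m - low_monom n a m * low n k \<in> uea_ideal (sl n)"
proof -
  interpret sl: matrix_lie_algebra "sl n" by (rule matrix_lie_algebra_sl)
  have power: "low n k * low n j ^ e - low n j ^ e * low n k \<in> uea_ideal (sl n)" if "0 < j" "j < n" for j e
  proof (induction e)
    case (Suc e)
    show ?case
      unfolding power_Suc
      by (intro commutator_mult_ideal low_closed low_commute free_alg_on_power Suc k that)
  qed simp
  show ?thesis using m
  proof (induction m)
    case (Suc m)
    then show ?case
      unfolding low_monom.simps
      by (intro commutator_mult_ideal low_closed low_monom_closed free_alg_on_power power k) auto
  qed simp
qed

text \<open>
  Multiplication with a lowering operator raises an exponent. For the induction over the number \<open>m\<close> of
  factors the case \<open>k > m\<close> is included: then the factor with index \<open>k\<close> is not yet part of the monomial,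
  and the change of the exponent is invisible.
\<close>

lemma low_mult_monom:
  assumes k: "0 < k" "k < n" and a: "0 \<le> a k" and m: "m < n"
  shows "low n k * low_monom n a m - (if k \<le> m then low_monom n (a + \<epsilon> k - \<epsilon> 0) m
    else low n k * low_monom n (a + \<epsilon> k - \<epsilon> 0) m) \<in> uea_ideal (sl n)"
  using m
proof (induction m)
  case 0
  then show ?case using k matrix_lie_algebra.uea_ideal_0[OF matrix_lie_algebra_sl] by simp
next
  case (Suc m)
  interpret sl: matrix_lie_algebra "sl n" by (rule matrix_lie_algebra_sl)
  let ?a = "a + \<epsilon> k - \<epsilon> 0"
  have same: "?a j = a j" if "j \<noteq> k" "0 < j" for j
    using that by (simp add: unit_exp_def)
  have same_monom: "low_monom n ?a l = low_monom n a l" if "l < k" for l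
    using that by (induction l) (simp_all only: low_monom.simps same)
  consider "k \<le> m" | "k = Suc m" | "Suc m < k" by linarith
  then show ?case
  proof cases
    case 1
    have "(low n k * low_monom n a m - low_monom n ?a m) * low n (Suc m) ^ nat (a (Suc m)) \<in> uea_ideal (sl n)"
      using Suc 1 by (intro sl.uea_ideal_mult_right free_alg_on_power low_closed) auto
    then show ?thesis using 1 same[of "Suc m"] by (simp add: left_diff_distrib mult.assoc)
  next
    case 2
    have ak: "nat (?a k) = Suc (nat (a k))"
      using a k by (simp add: unit_exp_def nat_add_distrib)
    have "(low n k * low_monom n a m - low_monom n a m * low n k) * low n k ^ nat (a k) \<in> uea_ideal (sl n)"
      using k Suc(2) by (intro sl.uea_ideal_mult_right low_commute_monom free_alg_on_power low_closed) auto
    then show ?thesis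
      using 2 ak same_monom[of m] by (simp add: left_diff_distrib mult.assoc)
  next
    case 3
    then show ?thesis using same_monom[OF 3] by simp
  qed
qed

section \<open>Left ideals containing the relations of the highest weight vector\<close>

text \<open>
  These left ideals are the preimages of the submodules of the generalized Verma module; the smallest
  one is the preimage of the zero submodule. As scalars and generators
  generate the free algebra, closure under them makes \<open>L\<close> a left ideal.
\<close>

locale vacuum_left_ideal =
  fixes n :: nat and s :: complex and L :: "complex mat free_alg set"
  assumes n: "2 \<le> n"
    and L_closed: "f \<in> L \<Longrightarrow> f \<in> free_alg_on (sl n)"
    and L_add: "f \<in> L \<Longrightarrow> h \<in> L \<Longrightarrow> f + h \<in> L"
    and L_scal: "f \<in> L \<Longrightarrow> scal c * f \<in> L"
    and L_gen: "f \<in> L \<Longrightarrow> x \<in> sl n \<Longrightarrow> gen x * f \<in> L"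
    and L_ideal: "f \<in> uea_ideal (sl n) \<Longrightarrow> f \<in> L"
    and L_vacuum: "x \<in> parabolic n \<Longrightarrow> gen x - scal (s * x $$ (0, 0)) \<in> L"
begin

sublocale sl: matrix_lie_algebra "sl n" by (rule matrix_lie_algebra_sl)

lemma L_0: "0 \<in> L"
  by (rule L_ideal) simp

lemma L_uminus: "f \<in> L \<Longrightarrow> - f \<in> L"
  using L_scal[of f "- 1"] by (simp add: scal_minus)

lemma L_diff: "f \<in> L \<Longrightarrow> h \<in> L \<Longrightarrow> f - h \<in> L"
  using L_add[OF _ L_uminus] by fastforce

lemma L_trans: "f - h \<in> L \<Longrightarrow> h - k \<in> L \<Longrightarrow> f - k \<in> L"
  using L_add[of "f - h" "h - k"] by simp

lemma L_sym: "f - h \<in> L \<Longrightarrow> h - f \<in> L"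
  using L_uminus[of "f - h"] by simp

lemma L_add_cong: "f - h \<in> L \<Longrightarrow> f' - h' \<in> L \<Longrightarrow> (f + f') - (h + h') \<in> L"
  using L_add[of "f - h" "f' - h'"] by (simp add: algebra_simps)

lemma L_scal_cong: "f - h \<in> L \<Longrightarrow> scal c * f - scal c * h \<in> L"
  using L_scal[of "f - h" c] by (simp add: right_diff_distrib)

lemma L_gen_cong: "x \<in> sl n \<Longrightarrow> f - h \<in> L \<Longrightarrow> gen x * f - gen x * h \<in> L"
  using L_gen[of "f - h" x] by (simp add: right_diff_distrib)

lemma scal_gen_commute: "gen x * (scal c * f) = scal c * (gen x * f)"
  by (simp add: gen_def scal_def single_mult_word mult.assoc[symmetric])

abbreviation D :: "complex mat \<Rightarrow> laurent \<Rightarrow> laurent" where "D \<equiv> dop n s"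

text \<open>
  Modulo \<open>L\<close>, the map \<^const>\<open>low_poly\<close> turns the differential operator of \<open>x\<close> into left multiplication
  by \<open>x\<close>.
\<close>

definition intertwines :: "complex mat \<Rightarrow> laurent \<Rightarrow> bool" where
  "intertwines x F \<longleftrightarrow> gen x * low_poly n F - low_poly n (D x F) \<in> L"

lemma intertwines_0: "intertwines x 0"
proof -
  have "D x 0 = 0" by (simp add: dop_def fun_eq_iff)
  then show ?thesis using L_0 by (simp add: intertwines_def)
qed

lemma intertwines_add:
  assumes "F \<in> Pol n" "G \<in> Pol n" "intertwines x F" "intertwines x G"
  shows "intertwines x (F + G)"
  using L_add_cong[OF assms(3,4)[unfolded intertwines_def]] assms
  by (simp add: intertwines_def low_poly_add Pol_dop dop_plus distrib_left)

lemma intertwines_mult: "intertwines x F \<Longrightarrow> intertwines x (\<lambda>a. c * F a)"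
  using L_scal_cong[of "gen x * low_poly n F" "low_poly n (D x F)" c]
  by (simp add: intertwines_def low_poly_mult dop_mult scal_gen_commute)

lemma intertwines_extend:
  assumes "F \<in> Pol n" "\<And>b. b \<in> PolExp n \<Longrightarrow> intertwines x (delta b)"
  shows "intertwines x F"
  using assms(1)
proof (induction rule: Pol_induct)
  case zero
  show ?case by (rule intertwines_0)
next
  case (single c b)
  then show ?case by (intro intertwines_mult assms(2))
next
  case (add F G)
  then show ?case by (intro intertwines_add)
qed

lemma intertwines_add_mat:
  assumes "x \<in> sl n" "y \<in> sl n" "F \<in> Pol n" "intertwines x F" "intertwines y F"
  shows "intertwines (x + y) F"
proof -
  have "(gen (x + y) - gen x - gen y) * low_poly n F \<in> L"
    using assms by (intro L_ideal sl.uea_ideal_mult_right sl.gen_add_rel low_poly_closed)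
  from L_add[OF L_add[OF this assms(4)[unfolded intertwines_def]] assms(5)[unfolded intertwines_def]]
  show ?thesis
    using assms
    by (simp add: intertwines_def dop_add_mat sl_carrier low_poly_add Pol_dop algebra_simps)
qed

lemma intertwines_smult_mat:
  assumes "x \<in> sl n" "intertwines x F"
  shows "intertwines (c \<cdot>\<^sub>m x) F"
proof -
  have "(gen (c \<cdot>\<^sub>m x) - scal c * gen x) * low_poly n F \<in> L"
    using assms by (intro L_ideal sl.uea_ideal_mult_right sl.gen_smult_rel low_poly_closed)
  from L_add[OF this L_scal_cong[OF assms(2)[unfolded intertwines_def], of c]]
  show ?thesis
    using assms
    by (simp add: intertwines_def dop_smult_mat sl_carrier low_poly_mult algebra_simps)
qed

lemma intertwines_low:
  assumes k: "0 < k" "k < n" and F: "F \<in> Pol n"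
  shows "intertwines (mat_unit n k 0) F"
  using F
proof (rule intertwines_extend)
  fix b assume b: "b \<in> PolExp n"
  have "low n k * low_monom n b (n - 1) - low_monom n (b + \<epsilon> k - \<epsilon> 0) (n - 1) \<in> uea_ideal (sl n)"
    using low_mult_monom[OF k, of b "n - 1"] b k by (auto simp: PolExp_def split: if_splits)
  then show "intertwines (mat_unit n k 0) (delta b)"
    using L_ideal k by (simp add: intertwines_def dop_lower_delta low_poly_delta low_def)
qed

lemma low_monom_0: "low_monom n 0 m = 1"
  by (induction m) simp_all

text \<open>
  An element of \<open>sl n\<close> is brought into the parabolic subalgebra by subtracting multiples of the lowering
  operators one at a time; the induction runs over the last row with a nonzero entry in the first
  column.
\<close>

lemma intertwines_vacuum:
  assumes "x \<in> sl n"
  shows "intertwines x (delta 0)"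
proof -
  have "intertwines x (delta 0)" if "x \<in> sl n" "\<And>i. m < i \<Longrightarrow> i < n \<Longrightarrow> x $$ (i, 0) = 0" for m x
    using that
  proof (induction m arbitrary: x)
    case 0
    then have x: "x \<in> parabolic n" by (simp add: parabolic_iff[OF n])
    show ?case
      using L_vacuum[OF x]
      unfolding intertwines_def dop_parabolic_delta_0[OF n x] low_poly_mult low_poly_delta low_monom_0
      by simp
  next
    case (Suc m)
    show ?case
    proof (cases "Suc m < n")
      case False
      then show ?thesis using Suc by (intro Suc.IH) auto
    next
      case True
      let ?E = "mat_unit n (Suc m) 0"
      let ?c = "x $$ (Suc m, 0)"
      let ?y = "x + (- ?c) \<cdot>\<^sub>m ?E"
      have E: "?E \<in> sl n" by (simp add: mat_unit_sl)
      have y: "?y \<in> sl n" by (intro sl.add_closed sl.smult_closed E Suc.prems)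
      have xc: "x \<in> carrier_mat n n" by (rule sl_carrier[OF Suc.prems(1)])
      have "intertwines ?y (delta 0)"
      proof (rule Suc.IH[OF y])
        fix i assume "m < i" "i < n"
        then show "?y $$ (i, 0) = 0"
          using Suc.prems(2)[of i] True xc carrier_matD[OF mat_unit_carrier[of n "Suc m" 0]]
          by (cases "i = Suc m") auto
      qed
      moreover have "intertwines (?c \<cdot>\<^sub>m ?E) (delta 0)"
        using True by (intro intertwines_smult_mat E intertwines_low Pol_delta PolExp_0) auto
      ultimately have "intertwines (?y + ?c \<cdot>\<^sub>m ?E) (delta 0)"
        by (rule intertwines_add_mat[OF y sl.smult_closed[OF E] Pol_delta[OF PolExp_0]])
      moreover have "?y + ?c \<cdot>\<^sub>m ?E = x"
        using xc by (intro eq_matI) (auto simp: carrier_matD[OF mat_unit_carrier])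
      ultimately show ?thesis by (simp only:)
    qed
  qed
  from this[of x n] show ?thesis using assms by simp
qed

text \<open>
  A monomial \<open>b\<close> of positive degree arises from a monomial \<open>c\<close> of smaller degree by a lowering operator
  \<open>E\<close>. Modulo \<open>L\<close>, \<open>x E = E x + [x, E]\<close> is applied to \<open>c\<close>, where the induction hypothesis covers both \<open>x\<close>
  and \<open>[x, E]\<close>; since the differential operators satisfy the same bracket relation, the result is the
  one predicted for \<open>b\<close>.
\<close>

lemma intertwines_delta:
  assumes "b \<in> PolExp n" "x \<in> sl n"
  shows "intertwines x (delta b)"
  using assms
proof (induction "nat (- b 0)" arbitrary: b x rule: less_induct)
  case less
  show ?case
  proof (cases "b = 0")
    case True
    then show ?thesis using intertwines_vacuum less by simp
  next
    case False
    obtain k where k: "0 < k" "k < n" "0 < b k" "b 0 < 0"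
      using PolExp_nonzero[OF less.prems(1) False] .
    let ?E = "mat_unit n k 0"
    define c where "c = b + \<epsilon> 0 - \<epsilon> k"
    have E: "?E \<in> sl n" using k by (simp add: mat_unit_sl)
    have c: "c \<in> PolExp n" unfolding c_def using k n less.prems by (intro PolExp_shift) auto
    have "c 0 = b 0 + 1" using k by (simp add: c_def unit_exp_def)
    then have IH: "intertwines y (delta c)" if "y \<in> sl n" for y
      using less.hyps[OF _ c that] k by simp
    have b: "delta b = D ?E (delta c)"
      using k by (simp add: dop_lower_delta c_def)
    note x = less.prems(2)
    let ?g = "low_poly n"
    have cP: "delta c \<in> Pol n" by (rule Pol_delta[OF c])
    have 1: "gen x * ?g (delta b) - gen x * (gen ?E * ?g (delta c)) \<in> L"
      using intertwines_low[OF k(1,2) cP] by (intro L_gen_cong x) (simp add: intertwines_def b L_sym)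
    have "(gen x * gen ?E - gen ?E * gen x - gen (x * ?E - ?E * x)) * ?g (delta c) \<in> L"
      by (intro L_ideal sl.uea_ideal_mult_right sl.gen_bracket_rel x E low_poly_closed)
    then have 2: "gen x * (gen ?E * ?g (delta c)) -
        (gen ?E * (gen x * ?g (delta c)) + gen (x * ?E - ?E * x) * ?g (delta c)) \<in> L"
      by (simp add: algebra_simps)
    have "gen ?E * (gen x * ?g (delta c)) - gen ?E * ?g (D x (delta c)) \<in> L"
      using IH[OF x] by (intro L_gen_cong E) (simp add: intertwines_def)
    then have 3: "gen ?E * (gen x * ?g (delta c)) - ?g (D ?E (D x (delta c))) \<in> L"
      by (rule L_trans) (use intertwines_low[OF k(1,2) Pol_dop[OF cP]] in \<open>simp add: intertwines_def\<close>)
    have 4: "gen (x * ?E - ?E * x) * ?g (delta c) - ?g (D (x * ?E - ?E * x) (delta c)) \<in> L"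
      using IH[OF sl.bracket_closed[OF x E]] by (simp add: intertwines_def)
    have "gen x * ?g (delta b) - (?g (D ?E (D x (delta c))) + ?g (D (x * ?E - ?E * x) (delta c))) \<in> L"
      by (rule L_trans[OF L_trans[OF 1 2] L_add_cong[OF 3 4]])
    also have "?g (D ?E (D x (delta c))) + ?g (D (x * ?E - ?E * x) (delta c)) =
        ?g (D ?E (D x (delta c)) + D (x * ?E - ?E * x) (delta c))"
      by (intro low_poly_add[symmetric] Pol_dop cP)
    also have "D ?E (D x (delta c)) + D (x * ?E - ?E * x) (delta c) = D x (delta b)"
      by (simp add: dop_bracket sl_carrier x E b)
    finally show ?thesis by (simp add: intertwines_def)
  qed
qed

lemma intertwines_Pol: "x \<in> sl n \<Longrightarrow> F \<in> Pol n \<Longrightarrow> intertwines x F"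
  by (rule intertwines_extend) (auto intro: intertwines_delta)

text \<open>
  The image of \<^const>\<open>low_poly\<close> modulo \<open>L\<close> contains \<open>1\<close> and is closed under left multiplication by
  equivariance. This is the spanning half of a theorem of Poincare-Birkhoff-Witt type.
\<close>

lemma low_poly_spans:
  assumes "f \<in> free_alg_on (sl n)"
  obtains F where "F \<in> Pol n" "f - low_poly n F \<in> L"
proof -
  have "\<exists>F\<in>Pol n. f - low_poly n F \<in> L"
    using assms
  proof (induction rule: free_alg_on_word_induct)
    case one
    show ?case
      by (intro bexI[of _ "delta 0"]) (simp_all add: low_poly_delta low_monom_0 L_0 Pol_delta)
  next
    case (add f h)
    then obtain F H where "F \<in> Pol n" "H \<in> Pol n" "f - low_poly n F \<in> L" "h - low_poly n H \<in> L"
      by blast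
    then show ?case
      by (intro bexI[of _ "F + H"] Pol_add) (simp_all only: low_poly_add L_add_cong)
  next
    case (scal c f)
    then obtain F where "F \<in> Pol n" "f - low_poly n F \<in> L" by blast
    then show ?case
      by (intro bexI[of _ "\<lambda>a. c * F a"]) (simp_all add: low_poly_mult Pol_mult L_scal_cong)
  next
    case (gen x f)
    then obtain F where F: "F \<in> Pol n" "f - low_poly n F \<in> L" by blast
    have "gen x * f - low_poly n (D x F) \<in> L"
      by (rule L_trans[OF L_gen_cong[OF gen(1) F(2)]])
        (use intertwines_Pol[OF gen(1) F(1)] in \<open>simp add: intertwines_def\<close>)
    then show ?case using F by (intro bexI[of _ "D x F"]) (simp_all add: Pol_dop)
  qed
  then show ?thesis using that by blast
qed

lemma one_in_L_imp:
  assumes "1 \<in> L" "f \<in> free_alg_on (sl n)"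
  shows "f \<in> L"
  using assms(2) by (induction rule: free_alg_on_word_induct) (auto intro: assms(1) L_add L_scal L_gen)

lemma low_poly_constant:
  assumes F: "F \<in> Pol n" "F \<noteq> 0" "low_poly n F \<in> L" and supp: "\<And>a. F a \<noteq> 0 \<Longrightarrow> a = 0"
  shows "1 \<in> L"
proof -
  have eq: "F = (\<lambda>a. F 0 * delta 0 a)"
    by (rule ext) (use supp in \<open>auto simp: delta_def\<close>)
  obtain a where "F a \<noteq> 0" using F(2) by (metis ext zero_fun_apply)
  with supp[of a] have F0: "F 0 \<noteq> 0" by simp
  have "low_poly n F = scal (F 0) * low_poly n (delta 0)"
    by (subst eq, subst low_poly_mult) (rule refl)
  then have "scal (F 0) \<in> L" using F(3) by (simp add: low_poly_delta low_monom_0)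
  then have "scal (1 / F 0) * scal (F 0) \<in> L" by (rule L_scal)
  then show ?thesis using F0 by (simp add: scal_mult[symmetric])
qed

text \<open>
  Take any nonconstant monomial \<open>b\<close> occurring in \<open>F\<close>, and a variable \<open>k\<close> occurring in \<open>b\<close>. The raising
  operator \<open>E\<^sub>0\<^sub>,\<^sub>k\<close> maps distinct monomials to multiples of distinct monomials, so no cancellation can
  occur, and the coefficient \<open>b k * (s + b 0 + 1)\<close> is nonzero because \<open>- b 0 - 1\<close> is a natural number
  and \<open>s\<close> is not. Hence \<open>F\<close> is replaced by a nonzero polynomial with a smaller bound on the degree.
\<close>

lemma low_poly_descent:
  assumes s: "s \<notin> \<nat>" and F: "F \<in> Pol n" "F \<noteq> 0" "low_poly n F \<in> L"
    and deg: "\<And>a. F a \<noteq> 0 \<Longrightarrow> - a 0 \<le> int d"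
  shows "1 \<in> L"
  using F deg
proof (induction d arbitrary: F)
  case 0
  have "a = 0" if "F a \<noteq> 0" for a
  proof (rule ccontr)
    assume a: "a \<noteq> 0"
    have "a \<in> PolExp n" using 0(1) that by (auto simp: Pol_def)
    from PolExp_nonzero[OF this a] have "a 0 < 0" .
    then show False using 0(4)[OF that] by simp
  qed
  with 0 show ?case by (intro low_poly_constant) auto
next
  case (Suc d)
  show ?case
  proof (cases "\<forall>a. F a \<noteq> 0 \<longrightarrow> a = 0")
    case True
    with Suc show ?thesis by (intro low_poly_constant) auto
  next
    case False
    then obtain b where b: "F b \<noteq> 0" "b \<noteq> 0" by blast
    have "b \<in> PolExp n" using Suc.prems(1) b by (auto simp: Pol_def)
    then obtain k where k: "0 < k" "k < n" "0 < b k" "b 0 < 0"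
      using PolExp_nonzero[OF _ b(2)] by blast
    let ?E = "mat_unit n 0 k"
    have E: "?E \<in> sl n" using k by (simp add: mat_unit_sl)
    have DF: "D ?E F a = coef s 0 k (a - \<epsilon> 0 + \<epsilon> k) * F (a - \<epsilon> 0 + \<epsilon> k)" for a
      using k n by (intro dop_mat_unit) auto
    have "s + of_int (b 0) + 1 \<noteq> 0"
    proof
      assume 0: "s + of_int (b 0) + 1 = 0"
      have "s = (s + of_int (b 0) + 1) + of_int (- b 0 - 1)" by simp
      then have "s = of_int (- b 0 - 1)" unfolding 0 by simp
      also have "\<dots> = of_nat (nat (- b 0 - 1))" using k by simp
      finally show False using s by simp
    qed
    then have "D ?E F (b + \<epsilon> 0 - \<epsilon> k) \<noteq> 0"
      using b k unfolding DF by (simp add: coef_def)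
    then have "D ?E F \<noteq> 0" by auto
    moreover have "low_poly n (D ?E F) \<in> L"
    proof -
      have "gen ?E * low_poly n F \<in> L" using Suc.prems(3) E by (rule L_gen)
      from L_diff[OF this intertwines_Pol[OF E Suc.prems(1), unfolded intertwines_def]]
      show ?thesis by simp
    qed
    moreover have "- a 0 \<le> int d" if "D ?E F a \<noteq> 0" for a
    proof -
      have "F (a - \<epsilon> 0 + \<epsilon> k) \<noteq> 0" using that unfolding DF by auto
      from Suc.prems(4)[OF this] show ?thesis using k by (simp add: unit_exp_def)
    qed
    ultimately show ?thesis
      using Suc.prems(1) by (intro Suc.IH) (auto intro: Pol_dop)
  qed
qed

lemma low_poly_in_L_imp:
  assumes "s \<notin> \<nat>" "F \<in> Pol n" "F \<noteq> 0" "low_poly n F \<in> L"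
  shows "1 \<in> L"
proof -
  let ?d = "Max ((\<lambda>a. nat (- a 0)) ` {a. F a \<noteq> 0})"
  have "- a 0 \<le> int ?d" if "F a \<noteq> 0" for a
  proof -
    have "nat (- a 0) \<le> ?d" using assms(2) that by (intro Max_ge) (auto simp: Pol_def)
    then show ?thesis by linarith
  qed
  then show ?thesis using low_poly_descent[OF assms] by blast
qed

end

section \<open>Reducibility of the generalized Verma module\<close>

text \<open>
  Choosing the polynomial representative modulo the smaller left ideal \<open>L0\<close> ensures that it is nonzero,
  as otherwise \<open>f\<close> would belong to \<open>L0\<close>.
\<close>

lemma verma_maximal_ideal:
  assumes "vacuum_left_ideal n s L0" "vacuum_left_ideal n s L" "s \<notin> \<nat>" "L0 \<subseteq> L" "f \<in> L" "f \<notin> L0"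
  shows "1 \<in> L"
proof -
  interpret L0: vacuum_left_ideal n s L0 by fact
  interpret L: vacuum_left_ideal n s L by fact
  obtain F where F: "F \<in> Pol n" "f - low_poly n F \<in> L0"
    using L0.low_poly_spans[OF L.L_closed[OF assms(5)]] .
  have "F \<noteq> 0" using F(2) assms(6) by auto
  moreover have "low_poly n F \<in> L"
    using L.L_diff[OF assms(5), of "f - low_poly n F"] F(2) assms(4) by auto
  ultimately show ?thesis using L.low_poly_in_L_imp[OF assms(3) F(1)] by blast
qed

lemma gen_verma_simps:
  fixes s :: complex
  assumes n: "2 \<le> n" and f: "f \<in> free_alg_on (sl n)"
  defines "v \<equiv> induced_character.ind_vec (sl n) (parabolic n) (triv_rep n s)"
  shows "gen_verma_scale n s c (v f) = v (scal c * f)"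
    and "x \<in> sl n \<Longrightarrow> gen_verma_action n s x (v f) = v (gen x * f)"
proof -
  interpret induced_character "sl n" "parabolic n" "triv_rep n s" "\<lambda>x. s * x $$ (0, 0)"
    by (rule induced_character_parabolic[OF n])
  show "gen_verma_scale n s c (v f) = v (scal c * f)"
    unfolding gen_verma_scale_def v_def by (intro ind_action_vec f) simp
  show "gen_verma_action n s x (v f) = v (gen x * f)" if "x \<in> sl n"
    unfolding gen_verma_action_def v_def by (intro ind_action_vec f free_alg_on_gen that)
qed

lemma vacuum_left_ideal_vimage:
  fixes s :: complex
  assumes n: "2 \<le> n"
    and N: "lie_submodule (sl n) (gen_verma n s) (gen_verma_scale n s) (gen_verma_action n s) N"
  defines "v \<equiv> induced_character.ind_vec (sl n) (parabolic n) (triv_rep n s)"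
  shows "vacuum_left_ideal n s {f \<in> free_alg_on (sl n). v f \<in> N}"
proof -
  interpret induced_character "sl n" "parabolic n" "triv_rep n s" "\<lambda>x. s * x $$ (0, 0)"
    by (rule induced_character_parabolic[OF n])
  have N': "subgroup N M" "\<And>c m. m \<in> N \<Longrightarrow> gen_verma_scale n s c m \<in> N"
    "\<And>x m. x \<in> sl n \<Longrightarrow> m \<in> N \<Longrightarrow> gen_verma_action n s x m \<in> N"
    using N by (auto simp: lie_submodule_def gen_verma_def)
  note simps = gen_verma_simps[OF n, where s = s, folded v_def]
  have one: "\<one>\<^bsub>M\<^esub> \<in> N" by (rule subgroup.one_closed[OF N'(1)])
  show ?thesis
  proof
    fix f h c x assume f: "f \<in> {f \<in> free_alg_on (sl n). v f \<in> N}"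
    then show "f \<in> free_alg_on (sl n)" by simp
    show "scal c * f \<in> {f \<in> free_alg_on (sl n). v f \<in> N}"
      using f N'(2)[of "v f" c] by (auto simp: simps intro: free_alg_on_intros)
    show "gen x * f \<in> {f \<in> free_alg_on (sl n). v f \<in> N}" if "x \<in> sl n"
      using f N'(3)[of x "v f"] that by (auto simp: simps intro: free_alg_on_intros)
    assume "h \<in> {f \<in> free_alg_on (sl n). v f \<in> N}"
    with f show "f + h \<in> {f \<in> free_alg_on (sl n). v f \<in> N}"
      using subgroup.m_closed[OF N'(1)] by (auto simp: v_def ind_vec_add intro: free_alg_on_intros)
  next
    fix f assume "f \<in> uea_ideal (sl n)"
    then show "f \<in> {f \<in> free_alg_on (sl n). v f \<in> N}"
      using one ind_vec_eq_one_ideal g.uea_ideal_subset by (simp add: v_def)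
  next
    fix x assume x: "x \<in> parabolic n"
    then have "v (gen x - scal (s * x $$ (0, 0))) = \<one>\<^bsub>M\<^esub>"
      using ind_vec_char[of "gen x"] by (simp add: v_def free_alg_on_gen)
    then show "gen x - scal (s * x $$ (0, 0)) \<in> {f \<in> free_alg_on (sl n). v f \<in> N}"
      using one x sub by (auto intro!: free_alg_on_diff free_alg_on_gen)
  qed (rule n)
qed

lemma gen_verma_irreducible:
  assumes n: "2 \<le> n" and s: "s \<notin> \<nat>"
    and N: "lie_submodule (sl n) (gen_verma n s) (gen_verma_scale n s) (gen_verma_action n s) N"
    and nontriv: "N \<noteq> {\<one>\<^bsub>gen_verma n s\<^esub>}"
  shows "N = carrier (gen_verma n s)"
proof -
  interpret induced_character "sl n" "parabolic n" "triv_rep n s" "\<lambda>x. s * x $$ (0, 0)"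
    by (rule induced_character_parabolic[OF n])
  have sub_N: "subgroup N M" using N by (simp add: lie_submodule_def gen_verma_def)
  have one: "\<one>\<^bsub>M\<^esub> \<in> N" by (rule subgroup.one_closed[OF sub_N])
  have triv: "lie_submodule (sl n) (gen_verma n s) (gen_verma_scale n s) (gen_verma_action n s) {\<one>\<^bsub>M\<^esub>}"
  proof -
    have "gen_verma_scale n s c \<one>\<^bsub>M\<^esub> = \<one>\<^bsub>M\<^esub>" for c
      using gen_verma_simps(1)[OF n, of 0 s c] by (simp add: ind_vec_0)
    moreover have "gen_verma_action n s x \<one>\<^bsub>M\<^esub> = \<one>\<^bsub>M\<^esub>" if "x \<in> sl n" for x
      using gen_verma_simps(2)[OF n _ that, of 0 s] by (simp add: ind_vec_0)
    ultimately show ?thesis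
      using group.triv_subgroup[OF group_M] by (simp add: lie_submodule_def gen_verma_def)
  qed
  let ?L = "{f \<in> free_alg_on (sl n). ind_vec f \<in> N}"
  let ?Ltriv = "{f \<in> free_alg_on (sl n). ind_vec f \<in> {\<one>\<^bsub>M\<^esub>}}"
  have L: "vacuum_left_ideal n s ?L" by (rule vacuum_left_ideal_vimage[OF n N])
  have L0: "vacuum_left_ideal n s ?Ltriv" by (rule vacuum_left_ideal_vimage[OF n triv])
  obtain m where m: "m \<in> N" "m \<noteq> \<one>\<^bsub>M\<^esub>"
    using nontriv one by (auto simp: gen_verma_def)
  obtain f where f: "f \<in> free_alg_on (sl n)" "m = ind_vec f"
    using ind_vec_surj[OF subgroup.mem_carrier[OF sub_N m(1)]] .
  have 1: "1 \<in> ?L"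
  proof (rule verma_maximal_ideal[OF L0 L s])
    show "?Ltriv \<subseteq> ?L" using one by auto
    show "f \<in> ?L" using m(1) f by simp
    show "f \<notin> ?Ltriv" using m(2) f(2) by simp
  qed
  have "carrier M \<subseteq> N"
  proof
    fix m assume "m \<in> carrier M"
    then obtain f where f: "f \<in> free_alg_on (sl n)" "m = ind_vec f" by (rule ind_vec_surj)
    from vacuum_left_ideal.one_in_L_imp[OF L 1 f(1)] f(2) show "m \<in> N" by simp
  qed
  then show ?thesis using subgroup.subset[OF sub_N] by (auto simp: gen_verma_def)
qed

definition high_degree :: "nat \<Rightarrow> laurent set" where
  "high_degree m = {F. \<forall>a. F a \<noteq> 0 \<longrightarrow> int m < - a 0}"

text \<open>
  Only the raising operators decrease the degree, and only by one. From degree \<open>m + 1\<close> to degree \<open>m\<close>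
  their coefficient contains the factor \<open>s - (m + 1) + 1 = 0\<close> for \<open>s = m\<close>.
\<close>

lemma dop_high_degree:
  assumes "F \<in> high_degree m"
  shows "dop n (of_nat m) A F \<in> high_degree m"
  unfolding high_degree_def mem_Collect_eq
proof (intro allI impI)
  fix a assume nz: "dop n (of_nat m) A F a \<noteq> 0"
  obtain i j where ij: "i < n" "j < n" "coef (of_nat m) i j (a - \<epsilon> i + \<epsilon> j) \<noteq> 0" "F (a - \<epsilon> i + \<epsilon> j) \<noteq> 0"
    using dop_nonzero[OF nz] .
  define c where "c = a - \<epsilon> i + \<epsilon> j"
  have c: "int m < - c 0" using assms ij(4) by (auto simp: high_degree_def c_def)
  have a0: "a 0 = c 0 + \<epsilon> i 0 - \<epsilon> j 0" by (simp add: c_def)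
  show "int m < - a 0"
  proof (cases "i = 0 \<and> j \<noteq> 0")
    case True
    then have "of_nat m + of_int (c 0) + 1 \<noteq> (0 :: complex)"
      using ij(3) by (auto simp: coef_def c_def)
    then have "int m + c 0 + 1 \<noteq> 0"
      by (metis of_int_0 of_int_1 of_int_add of_int_of_nat_eq)
    then show ?thesis using c a0 True by (simp add: unit_exp_def)
  next
    case False
    then show ?thesis using c a0 by (auto simp: unit_exp_def split: if_splits)
  qed
qed

lemma act_low_power:
  assumes "0 < k" "k < n"
  shows "act (dop n s) (low n k ^ d) (delta 0) = delta (\<lambda>j. int d * (\<epsilon> k - \<epsilon> 0) j)"
proof (induction d)
  case 0
  have "(\<lambda>j. int 0 * (\<epsilon> k - \<epsilon> 0) j) = 0" by (simp add: fun_eq_iff)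
  then show ?case by (simp only: power_0 act_1)
next
  case (Suc d)
  have "(\<lambda>j. int d * (\<epsilon> k - \<epsilon> 0) j) + \<epsilon> k - \<epsilon> 0 = (\<lambda>j. int (Suc d) * (\<epsilon> k - \<epsilon> 0) j)"
    by (simp add: fun_eq_iff algebra_simps)
  then show ?case
    unfolding power_Suc act_mult[OF linear_op_dop] Suc
    unfolding low_def act_gen
    using dop_lower_delta[OF assms] by simp
qed

text \<open>
  The submodule consists of the vectors whose image in the model is supported in degrees greater than
  \<open>m\<close>. It contains \<open>y\<^sub>1\<^bsup>m + 1\<^esup> \<otimes> 1\<close>, which is nonzero because its image in the model is, and it does not
  contain \<open>1 \<otimes> 1\<close>, whose image has degree \<open>0\<close>.
\<close>

lemma gen_verma_reducible:
  assumes n: "2 \<le> n"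
  shows "lie_reducible (sl n) (gen_verma n (of_nat m)) (gen_verma_scale n (of_nat m)) (gen_verma_action n (of_nat m))"
proof -
  let ?s = "of_nat m :: complex"
  interpret induced_character "sl n" "parabolic n" "triv_rep n ?s" "\<lambda>x. ?s * x $$ (0, 0)"
    by (rule induced_character_parabolic[OF n])
  note lin = linear_op_dop[of n ?s]
  let ?D = "dop n ?s"
  let ?S = "{f \<in> free_alg_on (sl n). act ?D f (delta 0) \<in> high_degree m}"
  have eq_act: "act ?D f (delta 0) = act ?D h (delta 0)"
    if "f \<in> free_alg_on (sl n)" "h \<in> free_alg_on (sl n)" "ind_vec f = ind_vec h" for f h
  proof -
    have "ind_vec (f - h) = ind_vec f \<otimes>\<^bsub>M\<^esub> inv\<^bsub>M\<^esub> ind_vec h"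
      using ind_vec_add[of f "- h"] that by (simp add: ind_vec_uminus free_alg_on_uminus)
    also have "\<dots> = \<one>\<^bsub>M\<^esub>"
      using that by (simp add: group.r_inv[OF group_M] ind_vec_carrier)
    finally have "act ?D (f - h) (delta 0) = 0"
      using that by (intro ind_vec_eq_one_imp_act[OF n]) (auto simp: gen_verma_def intro: free_alg_on_intros)
    then show ?thesis by (simp add: act_diff)
  qed
  have high_degree_0: "0 \<in> high_degree m" by (simp add: high_degree_def)
  have high_degree_add: "F + G \<in> high_degree m" if "F \<in> high_degree m" "G \<in> high_degree m" for F G
    using that by (force simp: high_degree_def)
  have high_degree_mult: "(\<lambda>a. c * F a) \<in> high_degree m" if "F \<in> high_degree m" for c F
    using that by (simp add: high_degree_def)
  have S_0: "0 \<in> ?S" using high_degree_0 by simp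
  have S_add: "f + h \<in> ?S" if "f \<in> ?S" "h \<in> ?S" for f h
    using that high_degree_add by (auto simp: act_add intro: free_alg_on_intros)
  have S_scal: "scal c * f \<in> ?S" if "f \<in> ?S" for c f
    using that high_degree_mult by (auto simp: act_mult[OF lin] act_scal intro: free_alg_on_intros)
  have S_gen: "gen x * f \<in> ?S" if "f \<in> ?S" "x \<in> sl n" for x f
    using that dop_high_degree by (auto simp: act_mult[OF lin] act_gen intro: free_alg_on_intros)
  have S_uminus: "- f \<in> ?S" if "f \<in> ?S" for f
    using S_scal[OF that, of "- 1"] by (simp add: scal_minus)
  have "subgroup (ind_vec ` ?S) M"
  proof
    show "ind_vec ` ?S \<subseteq> carrier M" using ind_vec_carrier by auto
    show "\<one>\<^bsub>M\<^esub> \<in> ind_vec ` ?S" unfolding ind_vec_0[symmetric] by (rule imageI[OF S_0])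
  next
    fix x y assume "x \<in> ind_vec ` ?S" "y \<in> ind_vec ` ?S"
    then obtain f h where "f \<in> ?S" "h \<in> ?S" "x = ind_vec f" "y = ind_vec h" by blast
    then have "x \<otimes>\<^bsub>M\<^esub> y = ind_vec (f + h)" by (simp add: ind_vec_add)
    then show "x \<otimes>\<^bsub>M\<^esub> y \<in> ind_vec ` ?S" using S_add \<open>f \<in> ?S\<close> \<open>h \<in> ?S\<close> by blast
  next
    fix x assume "x \<in> ind_vec ` ?S"
    then obtain f where "f \<in> ?S" "x = ind_vec f" by blast
    then have "inv\<^bsub>M\<^esub> x = ind_vec (- f)" by (simp add: ind_vec_uminus)
    then show "inv\<^bsub>M\<^esub> x \<in> ind_vec ` ?S" using S_uminus \<open>f \<in> ?S\<close> by blast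
  qed
  moreover have "gen_verma_scale n ?s c x \<in> ind_vec ` ?S" if "x \<in> ind_vec ` ?S" for c x
  proof -
    from that obtain f where f: "f \<in> ?S" "x = ind_vec f" by blast
    then have "gen_verma_scale n ?s c x = ind_vec (scal c * f)"
      using gen_verma_simps(1)[OF n] by simp
    then show ?thesis using S_scal[OF f(1)] by blast
  qed
  moreover have "gen_verma_action n ?s y x \<in> ind_vec ` ?S" if "x \<in> ind_vec ` ?S" "y \<in> sl n" for y x
  proof -
    from that obtain f where f: "f \<in> ?S" "x = ind_vec f" by blast
    then have "gen_verma_action n ?s y x = ind_vec (gen y * f)"
      using gen_verma_simps(2)[OF n _ that(2)] by simp
    then show ?thesis using S_gen[OF f(1) that(2)] by blast
  qed
  ultimately have "lie_submodule (sl n) (gen_verma n ?s) (gen_verma_scale n ?s) (gen_verma_action n ?s) (ind_vec ` ?S)"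
    by (simp add: lie_submodule_def gen_verma_def)
  moreover have "ind_vec ` ?S \<noteq> {\<one>\<^bsub>M\<^esub>}"
  proof
    assume *: "ind_vec ` ?S = {\<one>\<^bsub>M\<^esub>}"
    let ?f = "low n 1 ^ Suc m"
    let ?b = "\<lambda>j. int (Suc m) * (\<epsilon> 1 - \<epsilon> 0) j"
    have f: "?f \<in> free_alg_on (sl n)" by (intro free_alg_on_power low_closed) simp
    have act_f: "act ?D ?f (delta 0) = delta ?b"
      using n by (intro act_low_power) auto
    have "delta ?b \<in> high_degree m" by (simp add: high_degree_def delta_def unit_exp_def)
    with f have "?f \<in> ?S" by (simp only: mem_Collect_eq act_f)
    then have "ind_vec ?f \<in> ind_vec ` ?S" by (rule imageI)
    then have "ind_vec ?f = ind_vec 0" unfolding * ind_vec_0 by (rule singletonD)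
    then have "act ?D ?f (delta 0) = act ?D 0 (delta 0)"
      by (rule eq_act[OF f free_alg_on_0])
    then have "delta ?b = 0" unfolding act_f act_0 .
    from fun_cong[OF this, of ?b] show False by (simp add: delta_def)
  qed
  moreover have "ind_vec ` ?S \<noteq> carrier M"
  proof
    assume "ind_vec ` ?S = carrier M"
    then have "ind_vec 1 \<in> ind_vec ` ?S" using ind_vec_carrier[of 1] by simp
    then obtain f where f: "f \<in> ?S" "ind_vec 1 = ind_vec f" by blast
    then have "act ?D 1 (delta 0) = act ?D f (delta 0)" by (intro eq_act) auto
    with f have "delta 0 \<in> high_degree m" by simp
    then have "delta 0 0 \<noteq> 0 \<Longrightarrow> int m < - (0 :: exponent) 0" unfolding high_degree_def by blast
    then show False by (simp add: delta_def)
  qed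
  ultimately show ?thesis
    unfolding lie_reducible_def gen_verma_def by blast
qed

theorem corollary5p24:
  fixes n :: nat and s :: complex
  assumes "n \<ge> 2"
  shows "lie_reducible (sl n) (gen_verma n s) (gen_verma_scale n s) (gen_verma_action n s)
    \<longleftrightarrow> s \<in> \<nat>"
proof
  assume "lie_reducible (sl n) (gen_verma n s) (gen_verma_scale n s) (gen_verma_action n s)"
  then show "s \<in> \<nat>"
    unfolding lie_reducible_def using gen_verma_irreducible[OF assms] by blast
next
  assume "s \<in> \<nat>"
  then show "lie_reducible (sl n) (gen_verma n s) (gen_verma_scale n s) (gen_verma_action n s)"
    using gen_verma_reducible[OF assms] by (auto elim: Nats_cases)
qed

end
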